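(* Consider the first-order semi-implicit (SI) time discretization, defined in the context, of the nondimensional thermal rotating shallow water equations augmented by the potential vorticity equation, with Rossby number $\varepsilon$. Assume that the discrete initial data satisfy $$\mathbf v^0=\mathbf v^{(0),0}+\mathcal O(\varepsilon),\quad \omega^0=\omega^{(0),0}+\mathcal O(\varepsilon),\quad \psi^0=\psi^{(0),0}+\mathcal O(\varepsilon),\quad \theta^0=\theta^{(0),0}+\mathcal O(\varepsilon),$$ and, in addition, assume that $\mathbf v^{(0),0}$, $\omega^{(0),0}$, and $\psi^{(0),0}$ satisfy $$\mathbf v^{(0),0}=\nabla^\perp\psi^{(0),0},\qquad \Delta\psi^{(0),0}=\omega^{(0),0}.$$ Then the SI scheme is asymptotic-preserving (AP) in the sense that its solution admits the same expansions at all time levels, that is, for every $n$, $$\mathbf v^n=\mathbf v^{(0),n}+\mathcal O(\varepsilon),\quad \omega^n=\omega^{(0),n}+\mathcal O(\varepsilon),\quad \psi^n=\psi^{(0),n}+\mathcal O(\varepsilon),\quad \theta^n=\theta^{(0),n}+\mathcal O(\varepsilon),$$ and the scheme provides a consistent discretization, as $\varepsilon\to0$, of the thermal quasi-geostrophic (TQG) equations $$\mathbf v^{(0)}=\nabla^\perp\psi^{(0)},\quad \Delta\psi^{(0)}=\omega^{(0)},$$ $$\Big(\frac{\partial}{\partial t}+\mathbf v^{(0)}\cdot\nabla\Big)\theta^{(0)}=0,\qquad \Big(\frac{\partial}{\partial t}+\mathbf v^{(0)}\cdot\nabla\Big)q^{(0)}=\frac1\nu\big[\psi^{(0)},\thet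a^{(0)}\big].$$
   Context: Notation. $\mathbf x=(x,y)\in\Omega$, where $\Omega\subset\mathbb R^2$ is a bounded domain; $\mathbf v=(u,v)^\top$ is the velocity; for a vector $\mathbf w=(w_1,w_2)^\top$, $\mathbf w^\perp:=(-w_2,w_1)^\top$; $\nabla^\perp:=(-\partial_y,\partial_x)^\top$; $[f,g]:=f_xg_y-f_yg_x$ is the 2-D Jacobian operator. The superscript $(0)$ denotes the leading-order term of an asymptotic expansion $\pi=\pi^{(0)}+\varepsilon\pi^{(1)}+\cdots$ with respect to $\varepsilon$. Underlying system (nondimensional thermal rotating shallow water equations under the TQG scaling, augmented by the potential vorticity equation), with unknowns velocity $\mathbf v$, depth perturbation $\phi$, buoyancy perturbation $\theta$, and potential vorticity $q:=\omega+\bar\beta y-\phi/\nu$, where $\omega:=v_x-u_y$ is the vorticity: $$\mathbf v_t+\mathbf v\cdot\nabla\mathbf v+\Big(\tfrac1\varepsilon+\bar\beta y\Big)\mathbf v^\perp=-\tfrac1\varepsilon\nabla(\phi+\theta)-\tfrac1\nu(\phi\nabla\theta+2\theta\nabla\phi),\quad \phi_t+\mathbf v\cdot\nabla\phi+\Big(\phi+\tfrac\nu\varepsilon\Big)\nabla\cdot\mathbf v=0,$$ $$\theta_t+\mathbf v\cdot\nabla\theta=0,\quad q_t+\mathbf v\cdot\nabla q+q\,\nabla\cdot\mathbf v=\tfrac1\nu[\phi,\theta].$$ Here $\varepsilon\ll1$ is the Rossby number, $\nu=\mathcal O(1)$ is the Burger number, and $\bar\beta\ge0$ is a constant (nondimensional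 variation of the Coriolis parameter). Set $\psi:=\phi+\theta$ (geostrophic streamfunction), $h:=1+\frac{\varepsilon}{\nu}\phi$, $\Theta:=1+\frac{2\varepsilon}{\nu}\theta$. In the TQG equations, $\psi^{(0)}=\phi^{(0)}+\theta^{(0)}$ and $q^{(0)}=\omega^{(0)}+\bar\beta y-\phi^{(0)}/\nu$. First-order SI scheme (discrete in time, continuous in space). The superscripts $n$ and $n+1$ denote data at the time levels $t^n$ and $t^{n+1}=t^n+\Delta t$, with $t^0=0$. Given $(\mathbf v^n,\phi^n,\theta^n,q^n)$, put $\psi^n=\phi^n+\theta^n$, $h^n=1+\frac\varepsilon\nu\phi^n$, $\Theta^n=1+\frac{2\varepsilon}\nu\theta^n$, $$a^n:=(1-\varepsilon)\min_{\Omega}h^n,\qquad b^n:=(1-\varepsilon)\min_{\Omega}\Theta^n,$$ and define the nonstiff terms $$\mathcal R^{\mathbf v,n}:=\mathbf v^n\cdot\nabla\mathbf v^n+\frac{\Theta^n-b^n}{\varepsilon}\nabla\phi^n+\frac{h^n-b^n}{\varepsilon}\nabla\theta^n+\frac{1+\varepsilon\bar\beta y-b^n}{\varepsilon}(\mathbf v^n)^\perp,$$ $$\mathcal R^{\phi,n}:=\mathbf v^n\cdot\nabla\phi^n+\nu\frac{h^n-a^n}{\varepsilon}\nabla\cdot\mathbf v^n,\quad \mathcal R^{\theta,n}:=\mathbf v^n\cdot\nabla\theta^n,\quad \mathcal R^{\psi,n}:=\mathcal R^{\phi,n}+\mathcal R^{\theta,n},$$ $$\mathcal R^{q,n}:=\mathbf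 v^n\cdot\nabla q^n+q^n\nabla\cdot\mathbf v^n-\tfrac1\nu[\phi^n,\theta^n].$$ The solution at level $n+1$ is obtained as follows. 1. $\theta^{n+1}=\theta^n-\Delta t\,\mathcal R^{\theta,n}$ and $q^{n+1}=q^n-\Delta t\,\mathcal R^{q,n}$. 2. $\psi^{n+1}$ is obtained by solving the linear elliptic equation $$\big(\varepsilon^2+a^nb^n(\Delta t)^2\big)\psi^{n+1}-\nu a^nb^n(\Delta t)^2\Delta\psi^{n+1}=\mathcal S^n,$$ $$\mathcal S^n=-a^nb^n(\Delta t)^2\big(\nu q^{n+1}-\nu\bar\beta y-\theta^{n+1}\big)-\varepsilon\nu a^n\Delta t\big(\nabla\cdot\mathbf v^n-\Delta t\,\nabla\cdot\mathcal R^{\mathbf v,n}\big)+\varepsilon^2\big(\psi^n-\Delta t\,\mathcal R^{\psi,n}\big),$$ and then $\phi^{n+1}=\psi^{n+1}-\theta^{n+1}$. 3. $\mathbf v^{n+1}$ is obtained by solving the linear algebraic system $$\varepsilon\mathbf v^{n+1}+b^n\Delta t\,(\mathbf v^{n+1})^\perp=\varepsilon\mathbf v^n-\varepsilon\Delta t\,\mathcal R^{\mathbf v,n}-b^n\Delta t\,\nabla\psi^{n+1}.$$ The vorticity at a time level is given, through the definition of $q$, by $\omega^n=q^n-\bar\beta y+\phi^n/\nu$.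
   Formalization: The elliptic equation for ψ^{n+1}, given without boundary condition (so the claim fails), is posed with an ε-independent boundary condition under which its smooth solutions depend stably on the right-hand side; O(ε) is meant in every C^k norm for smooth fields. *)

theory Defs
  imports "HOL-Analysis.Analysis" "HOL-Library.Landau_Symbols"
begin

section \<open>Smooth functions and expansions in the Rossby number\<close>

definition pdiff :: "'a::euclidean_space \<Rightarrow> ('a \<Rightarrow> 'b::real_normed_vector) \<Rightarrow> 'a \<Rightarrow> 'b" where
  "pdiff e f = (\<lambda>p. frechet_derivative f (at p) e)"

text \<open>
  A list \<open>es\<close> of basis vectors encodes the iterated partial derivative
  \<open>foldr pdiff es f\<close> of order \<open>length es\<close>.  The next predicate says that \<open>f\<close> is \<open>C\<^sup>\<infinity>\<close> on
  the open set \<open>S\<close> with all derivatives bounded; in particular it holds for functions that are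
  smooth up to the boundary of a bounded \<open>S\<close>.  Values outside \<open>S\<close> are irrelevant here and below.
\<close>

definition smooth_bounded :: "'a::euclidean_space set \<Rightarrow> ('a \<Rightarrow> 'b::real_normed_vector) \<Rightarrow> bool" where
  "smooth_bounded S f \<longleftrightarrow>
     (\<forall>es\<in>lists Basis. foldr pdiff es f differentiable_on S \<and> bounded (foldr pdiff es f ` S))"

text \<open>The \<open>C\<^sup>k(S)\<close> norm; meaningful when the derivatives are bounded on \<open>S\<close>.\<close>

definition Ck_norm :: "'a::euclidean_space set \<Rightarrow> nat \<Rightarrow> ('a \<Rightarrow> 'b::real_normed_vector) \<Rightarrow> real" where
  "Ck_norm S k f =
     Sup {norm (foldr pdiff es f p) | es p. es \<in> lists Basis \<and> length es \<le> k \<and> p \<in> S}"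

text \<open>
  \<open>F\<^sub>\<epsilon> = F\<^sub>0 + O(\<epsilon>)\<close> as \<open>\<epsilon> \<rightarrow> 0+\<close>.  Expansions may be differentiated term by term in space, so the
  remainder is \<open>O(\<epsilon>)\<close> in every \<open>C\<^sup>k\<close> norm.
\<close>

definition expands ::
  "'a::euclidean_space set \<Rightarrow> (real \<Rightarrow> 'a \<Rightarrow> 'b::real_normed_vector) \<Rightarrow> ('a \<Rightarrow> 'b) \<Rightarrow> bool" where
  "expands S F F0 \<longleftrightarrow>
     smooth_bounded S F0 \<and> (\<forall>\<^sub>F \<epsilon> in at_right 0. smooth_bounded S (F \<epsilon>)) \<and>
     (\<forall>k. (\<lambda>\<epsilon>. Ck_norm S k (\<lambda>p. F \<epsilon> p - F0 p)) \<in> O[at_right 0](\<lambda>\<epsilon>. \<epsilon>))"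

section \<open>Planar differential operators\<close>

type_synonym field = "real \<times> real \<Rightarrow> real"
type_synonym vfield = "real \<times> real \<Rightarrow> real \<times> real"

abbreviation dx :: "(real \<times> real \<Rightarrow> 'b::real_normed_vector) \<Rightarrow> real \<times> real \<Rightarrow> 'b" where
  "dx \<equiv> pdiff (1, 0)"

abbreviation dy :: "(real \<times> real \<Rightarrow> 'b::real_normed_vector) \<Rightarrow> real \<times> real \<Rightarrow> 'b" where
  "dy \<equiv> pdiff (0, 1)"

definition perp :: "real \<times> real \<Rightarrow> real \<times> real" where
  "perp w = (- snd w, fst w)"

definition grad :: "field \<Rightarrow> vfield" where
  "grad f p = (dx f p, dy f p)"

definition grad_perp :: "field \<Rightarrow> vfield" where
  "grad_perp f p = (- dy f p, dx f p)"

definition divergence :: "vfield \<Rightarrow> field" where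
  "divergence w p = fst (dx w p) + snd (dy w p)"

definition laplacian :: "field \<Rightarrow> field" where
  "laplacian f p = dx (dx f) p + dy (dy f) p"

definition jacobian :: "field \<Rightarrow> field \<Rightarrow> field" where
  "jacobian f g p = dx f p * dy g p - dy f p * dx g p"

text \<open>\<open>advect w f\<close> is \<open>w \<cdot> \<nabla>f\<close>, for scalar or vector valued \<open>f\<close>.\<close>

definition advect ::
  "vfield \<Rightarrow> (real \<times> real \<Rightarrow> 'b::real_normed_vector) \<Rightarrow> real \<times> real \<Rightarrow> 'b" where
  "advect w f p = fst (w p) *\<^sub>R dx f p + snd (w p) *\<^sub>R dy f p"

section \<open>The first-order semi-implicit scheme\<close>

record trsw =
  vel :: vfield    \<comment> \<open>\<open>v = (u, v)\<close>\<close>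
  dep :: field     \<comment> \<open>depth perturbation \<open>\<phi>\<close>\<close>
  buo :: field     \<comment> \<open>buoyancy perturbation \<open>\<theta>\<close>\<close>
  pvt :: field     \<comment> \<open>potential vorticity \<open>q\<close>\<close>

definition stream :: "trsw \<Rightarrow> field" where
  "stream s p = dep s p + buo s p"

definition vorticity :: "real \<Rightarrow> real \<Rightarrow> trsw \<Rightarrow> field" where
  "vorticity \<nu> \<beta> s p = pvt s p - \<beta> * snd p + dep s p / \<nu>"

definition hgt :: "real \<Rightarrow> real \<Rightarrow> trsw \<Rightarrow> field" where
  "hgt \<epsilon> \<nu> s p = 1 + \<epsilon> / \<nu> * dep s p"

definition Tht :: "real \<Rightarrow> real \<Rightarrow> trsw \<Rightarrow> field" where
  "Tht \<epsilon> \<nu> s p = 1 + 2 * \<epsilon> / \<nu> * buo s p"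

text \<open>
  The minima over the domain are infima over the open set \<open>\<Omega>\<close>, i.e. the minima over the closure
  for functions that extend continuously to it.
\<close>

definition acoef :: "(real \<times> real) set \<Rightarrow> real \<Rightarrow> real \<Rightarrow> trsw \<Rightarrow> real" where
  "acoef \<Omega> \<epsilon> \<nu> s = (1 - \<epsilon>) * (INF p\<in>\<Omega>. hgt \<epsilon> \<nu> s p)"

definition bcoef :: "(real \<times> real) set \<Rightarrow> real \<Rightarrow> real \<Rightarrow> trsw \<Rightarrow> real" where
  "bcoef \<Omega> \<epsilon> \<nu> s = (1 - \<epsilon>) * (INF p\<in>\<Omega>. Tht \<epsilon> \<nu> s p)"

definition Rv :: "(real \<times> real) set \<Rightarrow> real \<Rightarrow> real \<Rightarrow> real \<Rightarrow> trsw \<Rightarrow> vfield" where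
  "Rv \<Omega> \<epsilon> \<nu> \<beta> s p =
     advect (vel s) (vel s) p
     + ((Tht \<epsilon> \<nu> s p - bcoef \<Omega> \<epsilon> \<nu> s) / \<epsilon>) *\<^sub>R grad (dep s) p
     + ((hgt \<epsilon> \<nu> s p - bcoef \<Omega> \<epsilon> \<nu> s) / \<epsilon>) *\<^sub>R grad (buo s) p
     + ((1 + \<epsilon> * \<beta> * snd p - bcoef \<Omega> \<epsilon> \<nu> s) / \<epsilon>) *\<^sub>R perp (vel s p)"

definition Rphi :: "(real \<times> real) set \<Rightarrow> real \<Rightarrow> real \<Rightarrow> trsw \<Rightarrow> field" where
  "Rphi \<Omega> \<epsilon> \<nu> s p =
     advect (vel s) (dep s) p
     + \<nu> * ((hgt \<epsilon> \<nu> s p - acoef \<Omega> \<epsilon> \<nu> s) / \<epsilon>) * divergence (vel s) p"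

definition Rtheta :: "trsw \<Rightarrow> field" where
  "Rtheta s p = advect (vel s) (buo s) p"

definition Rpsi :: "(real \<times> real) set \<Rightarrow> real \<Rightarrow> real \<Rightarrow> trsw \<Rightarrow> field" where
  "Rpsi \<Omega> \<epsilon> \<nu> s p = Rphi \<Omega> \<epsilon> \<nu> s p + Rtheta s p"

definition Rq :: "real \<Rightarrow> trsw \<Rightarrow> field" where
  "Rq \<nu> s p =
     advect (vel s) (pvt s) p + pvt s p * divergence (vel s) p - 1 / \<nu> * jacobian (dep s) (buo s) p"

definition elliptic_rhs ::
  "(real \<times> real) set \<Rightarrow> real \<Rightarrow> real \<Rightarrow> real \<Rightarrow> real \<Rightarrow> trsw \<Rightarrow> trsw \<Rightarrow> field" where
  "elliptic_rhs \<Omega> \<epsilon> \<nu> \<beta> dt s s' p =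
     - (acoef \<Omega> \<epsilon> \<nu> s * bcoef \<Omega> \<epsilon> \<nu> s * dt\<^sup>2) * (\<nu> * pvt s' p - \<nu> * \<beta> * snd p - buo s' p)
     - \<epsilon> * \<nu> * acoef \<Omega> \<epsilon> \<nu> s * dt
         * (divergence (vel s) p - dt * divergence (Rv \<Omega> \<epsilon> \<nu> \<beta> s) p)
     + \<epsilon>\<^sup>2 * (stream s p - dt * Rpsi \<Omega> \<epsilon> \<nu> s p)"

text \<open>
  One time step from \<open>s\<close> to \<open>s'\<close>.  \<open>B\<close> is the class of functions satisfying the boundary
  condition that accompanies the elliptic equation at the new time level.  The update
  \<open>\<phi>' = \<psi>' - \<theta>'\<close> is built into \<open>stream s'\<close>.
\<close>

definition SI_step ::
  "(real \<times> real) set \<Rightarrow> field set \<Rightarrow> real \<Rightarrow> real \<Rightarrow> real \<Rightarrow> real \<Rightarrow> trsw \<Rightarrow> trsw \<Rightarrow> bool" where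
  "SI_step \<Omega> B \<epsilon> \<nu> \<beta> dt s s' \<longleftrightarrow>
     (\<forall>p\<in>\<Omega>. buo s' p = buo s p - dt * Rtheta s p) \<and>
     (\<forall>p\<in>\<Omega>. pvt s' p = pvt s p - dt * Rq \<nu> s p) \<and>
     smooth_bounded \<Omega> (stream s') \<and> stream s' \<in> B \<and>
     (\<forall>p\<in>\<Omega>. (\<epsilon>\<^sup>2 + acoef \<Omega> \<epsilon> \<nu> s * bcoef \<Omega> \<epsilon> \<nu> s * dt\<^sup>2) * stream s' p
            - \<nu> * acoef \<Omega> \<epsilon> \<nu> s * bcoef \<Omega> \<epsilon> \<nu> s * dt\<^sup>2 * laplacian (stream s') p
            = elliptic_rhs \<Omega> \<epsilon> \<nu> \<beta> dt s s' p) \<and>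
     (\<forall>p\<in>\<Omega>. \<epsilon> *\<^sub>R vel s' p + (bcoef \<Omega> \<epsilon> \<nu> s * dt) *\<^sub>R perp (vel s' p)
            = \<epsilon> *\<^sub>R vel s p - (\<epsilon> * dt) *\<^sub>R Rv \<Omega> \<epsilon> \<nu> \<beta> s p
              - (bcoef \<Omega> \<epsilon> \<nu> s * dt) *\<^sub>R grad (stream s') p)"

text \<open>
  Dividing the elliptic equation by \<open>a b \<Delta>t\<^sup>2\<close> gives \<open>\<mu> \<psi> - \<nu> \<Delta>\<psi> = f\<close> with
  \<open>\<mu> = 1 + \<epsilon>\<^sup>2 / (a b \<Delta>t\<^sup>2)\<close>, which tends to \<open>1\<close>.  A boundary condition is admissible if, in the
  sense of Hadamard, solutions depend continuously on \<open>f\<close> in the \<open>C\<^sup>\<infinity>\<close> topology, uniformly for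
  \<open>\<mu>\<close> near \<open>1\<close>; a loss of derivatives is allowed.  By elliptic regularity this holds, for example,
  for Dirichlet or Neumann conditions on smoothly bounded domains.
\<close>

definition elliptic_stable :: "(real \<times> real) set \<Rightarrow> real \<Rightarrow> field set \<Rightarrow> bool" where
  "elliptic_stable \<Omega> \<nu> B \<longleftrightarrow>
     (\<forall>k. \<exists>m C. \<forall>\<mu>\<in>{1..2}. \<forall>w1\<in>B. \<forall>w2\<in>B. smooth_bounded \<Omega> w1 \<longrightarrow> smooth_bounded \<Omega> w2 \<longrightarrow>
        Ck_norm \<Omega> k (\<lambda>p. w1 p - w2 p)
        \<le> C * Ck_norm \<Omega> m (\<lambda>p. (\<mu> * w1 p - \<nu> * laplacian w1 p) - (\<mu> * w2 p - \<nu> * laplacian w2 p)))"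

section \<open>The thermal quasi-geostrophic equations\<close>

record tqg =
  vel0 :: vfield
  vort0 :: field
  psi0 :: field
  theta0 :: field

definition phi0 :: "tqg \<Rightarrow> field" where
  "phi0 y p = psi0 y p - theta0 y p"

definition q0 :: "real \<Rightarrow> real \<Rightarrow> tqg \<Rightarrow> field" where
  "q0 \<nu> \<beta> y p = vort0 y p + \<beta> * snd p - phi0 y p / \<nu>"

definition geostrophic :: "(real \<times> real) set \<Rightarrow> tqg \<Rightarrow> bool" where
  "geostrophic \<Omega> y \<longleftrightarrow>
     (\<forall>p\<in>\<Omega>. vel0 y p = grad_perp (psi0 y) p \<and> laplacian (psi0 y) p = vort0 y p)"

text \<open>Smooth solutions \<open>Y\<close> of the TQG equations for times in \<open>(0, T)\<close>; smoothness is joint in \<open>(t, p)\<close>.\<close>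

definition TQG_solution ::
  "(real \<times> real) set \<Rightarrow> real \<Rightarrow> real \<Rightarrow> real \<Rightarrow> (real \<Rightarrow> tqg) \<Rightarrow> bool" where
  "TQG_solution \<Omega> \<nu> \<beta> T Y \<longleftrightarrow>
     smooth_bounded ({0<..<T} \<times> \<Omega>) (\<lambda>(t, p). vel0 (Y t) p) \<and>
     smooth_bounded ({0<..<T} \<times> \<Omega>) (\<lambda>(t, p). vort0 (Y t) p) \<and>
     smooth_bounded ({0<..<T} \<times> \<Omega>) (\<lambda>(t, p). psi0 (Y t) p) \<and>
     smooth_bounded ({0<..<T} \<times> \<Omega>) (\<lambda>(t, p). theta0 (Y t) p) \<and>
     (\<forall>t\<in>{0<..<T}. geostrophic \<Omega> (Y t) \<and>
        (\<forall>p\<in>\<Omega>. deriv (\<lambda>\<tau>. theta0 (Y \<tau>) p) t + advect (vel0 (Y t)) (theta0 (Y t)) p = 0 \<and>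
               deriv (\<lambda>\<tau>. q0 \<nu> \<beta> (Y \<tau>) p) t + advect (vel0 (Y t)) (q0 \<nu> \<beta> (Y t)) p
                 = 1 / \<nu> * jacobian (psi0 (Y t)) (theta0 (Y t)) p))"

text \<open>
  The time discretization of the TQG equations that is the formal \<open>\<epsilon> = 0\<close> limit of the scheme,
  written as a defect: the numerical solution has defect \<open>0\<close> on \<open>\<Omega>\<close>.  The diagnostic relations are
  imposed at the new time level.
\<close>

definition TQG_defect ::
  "real \<Rightarrow> real \<Rightarrow> real \<Rightarrow> tqg \<Rightarrow> tqg \<Rightarrow> real \<times> real \<Rightarrow> (real \<times> real) \<times> real \<times> real \<times> real" where
  "TQG_defect \<nu> \<beta> dt y y' p =
     (vel0 y' p - grad_perp (psi0 y') p,
      laplacian (psi0 y') p - vort0 y' p,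
      (theta0 y' p - theta0 y p) / dt + advect (vel0 y) (theta0 y) p,
      (q0 \<nu> \<beta> y' p - q0 \<nu> \<beta> y p) / dt + advect (vel0 y) (q0 \<nu> \<beta> y) p
        - 1 / \<nu> * jacobian (psi0 y) (theta0 y) p)"

text \<open>
  Consistency of a one-step discretization given by its defect: the truncation error, i.e. the defect
  of an exact smooth solution, tends to zero with the time step, uniformly in space and time.
\<close>

definition TQG_consistent ::
  "(real \<times> real) set \<Rightarrow> real \<Rightarrow> real
   \<Rightarrow> (real \<Rightarrow> tqg \<Rightarrow> tqg \<Rightarrow> real \<times> real \<Rightarrow> 'c::real_normed_vector) \<Rightarrow> bool" where
  "TQG_consistent \<Omega> \<nu> \<beta> defect \<longleftrightarrow>
     (\<forall>T Y. TQG_solution \<Omega> \<nu> \<beta> T Y \<longrightarrow>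
        (\<forall>e>0. \<forall>\<^sub>F dt in at_right 0. \<forall>t. 0 < t \<and> t + dt < T \<longrightarrow>
           (\<forall>p\<in>\<Omega>. norm (defect dt (Y t) (Y (t + dt)) p) < e)))"

section \<open>Expansion of a family of states\<close>

definition expands_state ::
  "(real \<times> real) set \<Rightarrow> real \<Rightarrow> real \<Rightarrow> (real \<Rightarrow> trsw) \<Rightarrow> tqg \<Rightarrow> bool" where
  "expands_state \<Omega> \<nu> \<beta> Z y \<longleftrightarrow>
     expands \<Omega> (\<lambda>\<epsilon>. vel (Z \<epsilon>)) (vel0 y) \<and>
     expands \<Omega> (\<lambda>\<epsilon>. vorticity \<nu> \<beta> (Z \<epsilon>)) (vort0 y) \<and>
     expands \<Omega> (\<lambda>\<epsilon>. stream (Z \<epsilon>)) (psi0 y) \<and>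
     expands \<Omega> (\<lambda>\<epsilon>. buo (Z \<epsilon>)) (theta0 y)"

end

theory Submission
  imports Defs
begin

text \<open>
  Everything rests on a calculus for functions that depend on the Rossby number \<open>\<epsilon>\<close>.  Families that are
  \<open>O(r)\<close> in every \<open>C\<^sup>k\<close> norm are closed under sums, derivatives and bilinear products, the rates being
  multiplied (\<open>Ck_bigo_add\<close>, \<open>Ck_bigo_bilinear\<close>).  Consequently expansions with an \<open>O(\<epsilon>)\<close> remainder can be
  added, multiplied and differentiated term by term.

  The AP property is proved by induction over the time levels; one step is
  \<open>SI_step_preserves_expansion\<close>.  The updates of \<open>\<theta>\<close> and \<open>q\<close> are explicit.  The stiffness enters through the
  quotients \<open>(\<Theta> - b) / \<epsilon>\<close> and the like, but \<open>a\<close> and \<open>b\<close> are \<open>1 + O(\<epsilon>)\<close> (\<open>near_INF\<close>), and the scheme multiplies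
  the nonstiff terms by \<open>\<epsilon>\<close> wherever they meet the stiff part, so they drop out of the leading order.  What is
  left of the elliptic equation is \<open>\<psi> - \<nu> \<Delta>\<psi> = - (\<nu> q - \<nu> \<beta> y - \<theta>)\<close>, that is \<open>\<Delta>\<psi> = \<omega>\<close>, and what is left of the momentum
  equation is \<open>perp v = - \<nabla>\<psi>\<close>.  Balance is thus restored at each new level, and with it \<open>\<nabla>\<cdot>v = 0\<close>
  (\<open>divergence_grad_perp\<close>, by symmetry of second derivatives), which turns the limit of the \<open>q\<close> update
  into a discretization of the TQG equation at the next step.

  The one object that is not computed explicitly is the limit of \<open>\<psi>\<close>.  Stability of the elliptic problem
  yields a Cauchy estimate between the solutions for two values of \<open>\<epsilon>\<close>, and the limit exists because the
  smooth functions are complete with respect to all \<open>C\<^sup>k\<close> norms together (\<open>elliptic_limit\<close>,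
  \<open>expands_of_Cauchy\<close>).

  Consistency of the limiting scheme is a Taylor estimate in time (\<open>forward_difference_consistent\<close>).
\<close>

section \<open>Partial derivatives on open sets\<close>

abbreviation partials :: "'a::euclidean_space list \<Rightarrow> ('a \<Rightarrow> 'b::real_normed_vector) \<Rightarrow> 'a \<Rightarrow> 'b" where
  "partials es f \<equiv> foldr pdiff es f"

lemma pdiff_eqI: "(f has_derivative f') (at p) \<Longrightarrow> pdiff e f p = f' e"
  by (simp add: pdiff_def flip: frechet_derivative_at)

lemma has_derivative_frechet:
  "f differentiable_on S \<Longrightarrow> open S \<Longrightarrow> p \<in> S \<Longrightarrow> (f has_derivative frechet_derivative f (at p)) (at p)"
  by (metis at_within_open differentiable_on_def frechet_derivative_works)

lemma pdiff_cong:
  assumes "open S" "p \<in> S" "\<And>x. x \<in> S \<Longrightarrow> f x = g x"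
  shows "pdiff e f p = pdiff e g p"
proof -
  have "(f has_derivative f') (at p) \<longleftrightarrow> (g has_derivative f') (at p)" for f'
    using has_derivative_transform_within_open[OF _ assms(1,2)] assms(3) by metis
  then show ?thesis by (simp add: pdiff_def frechet_derivative_def)
qed

lemma differentiable_on_cong:
  assumes "f differentiable_on S" "\<And>x. x \<in> S \<Longrightarrow> f x = g x"
  shows "g differentiable_on S"
  using assms differentiable_transform_within[OF _ zero_less_one]
  unfolding differentiable_on_def by metis

lemma partials_cong:
  assumes "open S" "p \<in> S" "\<And>x. x \<in> S \<Longrightarrow> f x = g x"
  shows "partials es f p = partials es g p"
  using \<open>p \<in> S\<close>
proof (induction es arbitrary: p)
  case (Cons e es)
  then show ?case by (simp add: pdiff_cong[OF \<open>open S\<close>, of p "partials es f" "partials es g"])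
qed (use assms in auto)

lemma pdiff_add:
  assumes "open S" "f differentiable_on S" "g differentiable_on S" "p \<in> S"
  shows "pdiff e (\<lambda>p. f p + g p) p = pdiff e f p + pdiff e g p"
  using pdiff_eqI[OF has_derivative_add[OF has_derivative_frechet has_derivative_frechet]] assms
  by (force simp: pdiff_def)

lemma pdiff_bounded_linear:
  assumes "bounded_linear h" "open S" "f differentiable_on S" "p \<in> S"
  shows "pdiff e (\<lambda>p. h (f p)) p = h (pdiff e f p)"
  using pdiff_eqI[OF bounded_linear.has_derivative[OF assms(1) has_derivative_frechet]] assms(2-)
  by (force simp: pdiff_def)

lemma pdiff_bilinear:
  assumes "bounded_bilinear h" "open S" "f differentiable_on S" "g differentiable_on S" "p \<in> S"
  shows "pdiff e (\<lambda>p. h (f p) (g p)) p = h (pdiff e f p) (g p) + h (f p) (pdiff e g p)"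
  using pdiff_eqI[OF bounded_bilinear.FDERIV[OF assms(1) has_derivative_frechet has_derivative_frechet]]
    assms(2-) by (simp add: pdiff_def add.commute)

lemma pdiff_const [simp]: "pdiff e (\<lambda>p. c) = (\<lambda>p. 0)"
  by (simp add: pdiff_def)

lemma differentiable_on_bilinear:
  assumes "bounded_bilinear h" "f differentiable_on S" "g differentiable_on S"
  shows "(\<lambda>p. h (f p) (g p)) differentiable_on S"
  using assms bounded_bilinear.FDERIV unfolding differentiable_on_def differentiable_def by blast

lemma differentiable_on_bounded_linear:
  assumes "bounded_linear h" "f differentiable_on S"
  shows "(\<lambda>p. h (f p)) differentiable_on S"
  using assms bounded_linear.has_derivative unfolding differentiable_on_def differentiable_def by blast

lemma has_derivative_partials:
  fixes f :: "'a::euclidean_space \<Rightarrow> 'b::real_normed_vector"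
  assumes "f differentiable_on S" "open S" "p \<in> S"
  shows "(f has_derivative (\<lambda>h. \<Sum>e\<in>Basis. (h \<bullet> e) *\<^sub>R pdiff e f p)) (at p)"
proof -
  have *: "(f has_derivative frechet_derivative f (at p)) (at p)"
    using has_derivative_frechet assms by auto
  have "frechet_derivative f (at p) h = (\<Sum>e\<in>Basis. (h \<bullet> e) *\<^sub>R pdiff e f p)" for h
  proof -
    have "linear (frechet_derivative f (at p))"
      using * has_derivative_linear by blast
    then have "frechet_derivative f (at p) (\<Sum>e\<in>Basis. (h \<bullet> e) *\<^sub>R e)
        = (\<Sum>e\<in>Basis. (h \<bullet> e) *\<^sub>R pdiff e f p)"
      by (simp add: linear_sum linear_cmul pdiff_def)
    then show ?thesis by (simp add: euclidean_representation)
  qed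
  then show ?thesis using * by (metis (no_types, lifting) ext)
qed

section \<open>Families of functions of size \<open>O(r)\<close> in every \<open>C\<^sup>k\<close> norm\<close>

text \<open>The recursion differentiates first and asks for the remaining orders of the derivative family.  This
keeps the inductions below one-step: the derivative of a product is a sum of products, to which the
induction hypothesis applies, and the full Leibniz formula never appears.\<close>

primrec Ck_bigo :: "'a::euclidean_space set \<Rightarrow> (real \<Rightarrow> real) \<Rightarrow> nat
    \<Rightarrow> (real \<Rightarrow> 'a \<Rightarrow> 'b::real_normed_vector) \<Rightarrow> bool" where
  "Ck_bigo S r 0 F \<longleftrightarrow>
     (\<exists>K. \<forall>\<^sub>F \<epsilon> in at_right 0. F \<epsilon> differentiable_on S \<and> (\<forall>p\<in>S. norm (F \<epsilon> p) \<le> K * \<bar>r \<epsilon>\<bar>))"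
| "Ck_bigo S r (Suc k) F \<longleftrightarrow>
     (\<exists>K. \<forall>\<^sub>F \<epsilon> in at_right 0. F \<epsilon> differentiable_on S \<and> (\<forall>p\<in>S. norm (F \<epsilon> p) \<le> K * \<bar>r \<epsilon>\<bar>))
     \<and> (\<forall>e\<in>Basis. Ck_bigo S r k (\<lambda>\<epsilon>. pdiff e (F \<epsilon>)))"

lemma Ck_bigo_0: "Ck_bigo S r k F \<Longrightarrow> Ck_bigo S r 0 F"
  by (cases k) auto

lemma Ck_bigo_Suc: "Ck_bigo S r (Suc k) F \<longleftrightarrow> Ck_bigo S r 0 F \<and> (\<forall>e\<in>Basis. Ck_bigo S r k (\<lambda>\<epsilon>. pdiff e (F \<epsilon>)))"
  by simp

declare Ck_bigo.simps(2) [simp del]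

lemma Ck_bigo_SucD: "Ck_bigo S r (Suc k) F \<Longrightarrow> Ck_bigo S r k F"
proof (induction k arbitrary: F)
  case (Suc k) then show ?case by (simp only: Ck_bigo_Suc) blast
qed (simp only: Ck_bigo_Suc)

lemma Ck_bigo_cong:
  assumes "open S" "\<forall>\<^sub>F \<epsilon> in at_right 0. \<forall>p\<in>S. F \<epsilon> p = G \<epsilon> p" "Ck_bigo S r k F"
  shows "Ck_bigo S r k G"
  using assms(2,3)
proof (induction k arbitrary: F G)
  case 0
  then obtain K where "\<forall>\<^sub>F \<epsilon> in at_right 0. F \<epsilon> differentiable_on S \<and> (\<forall>p\<in>S. norm (F \<epsilon> p) \<le> K * \<bar>r \<epsilon>\<bar>)"
    by auto
  with 0(1) have "\<forall>\<^sub>F \<epsilon> in at_right 0. G \<epsilon> differentiable_on S \<and> (\<forall>p\<in>S. norm (G \<epsilon> p) \<le> K * \<bar>r \<epsilon>\<bar>)"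
    by eventually_elim (metis differentiable_on_cong)
  then show ?case by auto
next
  case (Suc k)
  have "Ck_bigo S r k (\<lambda>\<epsilon>. pdiff e (G \<epsilon>))" if "e \<in> Basis" for e
  proof (rule Suc.IH)
    show "\<forall>\<^sub>F \<epsilon> in at_right 0. \<forall>p\<in>S. pdiff e (F \<epsilon>) p = pdiff e (G \<epsilon>) p"
      using Suc.prems(1) by eventually_elim (use pdiff_cong[OF \<open>open S\<close>] in blast)
    show "Ck_bigo S r k (\<lambda>\<epsilon>. pdiff e (F \<epsilon>))"
      using Suc.prems that by (simp add: Ck_bigo_Suc)
  qed
  moreover have "Ck_bigo S r 0 G"
  proof -
    obtain K where "\<forall>\<^sub>F \<epsilon> in at_right 0. F \<epsilon> differentiable_on S \<and> (\<forall>p\<in>S. norm (F \<epsilon> p) \<le> K * \<bar>r \<epsilon>\<bar>)"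
      using Ck_bigo_0[OF Suc.prems(2)] by auto
    with Suc.prems(1) have "\<forall>\<^sub>F \<epsilon> in at_right 0. G \<epsilon> differentiable_on S \<and> (\<forall>p\<in>S. norm (G \<epsilon> p) \<le> K * \<bar>r \<epsilon>\<bar>)"
      by eventually_elim (metis differentiable_on_cong)
    then show ?thesis by auto
  qed
  ultimately show ?case by (simp add: Ck_bigo_Suc)
qed

lemma Ck_bigo_differentiable: "Ck_bigo S r k F \<Longrightarrow> \<forall>\<^sub>F \<epsilon> in at_right 0. F \<epsilon> differentiable_on S"
  by (drule Ck_bigo_0) (auto elim: eventually_mono)

lemma Ck_bigo_add:
  assumes "open S" "Ck_bigo S r k F" "Ck_bigo S r k G"
  shows "Ck_bigo S r k (\<lambda>\<epsilon> p. F \<epsilon> p + G \<epsilon> p)"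
  using assms(2,3)
proof (induction k arbitrary: F G)
  case 0
  then obtain K L where
    "\<forall>\<^sub>F \<epsilon> in at_right 0. F \<epsilon> differentiable_on S \<and> (\<forall>p\<in>S. norm (F \<epsilon> p) \<le> K * \<bar>r \<epsilon>\<bar>)"
    "\<forall>\<^sub>F \<epsilon> in at_right 0. G \<epsilon> differentiable_on S \<and> (\<forall>p\<in>S. norm (G \<epsilon> p) \<le> L * \<bar>r \<epsilon>\<bar>)" by auto
  then have "\<forall>\<^sub>F \<epsilon> in at_right 0. (\<lambda>p. F \<epsilon> p + G \<epsilon> p) differentiable_on S
      \<and> (\<forall>p\<in>S. norm (F \<epsilon> p + G \<epsilon> p) \<le> (K + L) * \<bar>r \<epsilon>\<bar>)"
    by eventually_elim (auto simp: distrib_right intro: differentiable_on_add norm_triangle_le add_mono)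
  then show ?case unfolding Ck_bigo.simps by blast
next
  case (Suc k)
  have "Ck_bigo S r k (\<lambda>\<epsilon>. pdiff e (\<lambda>p. F \<epsilon> p + G \<epsilon> p))" if "e \<in> Basis" for e
  proof (rule Ck_bigo_cong[OF \<open>open S\<close>])
    show "\<forall>\<^sub>F \<epsilon> in at_right 0. \<forall>p\<in>S. pdiff e (F \<epsilon>) p + pdiff e (G \<epsilon>) p = pdiff e (\<lambda>p. F \<epsilon> p + G \<epsilon> p) p"
      using Suc.prems[THEN Ck_bigo_differentiable]
      by eventually_elim (simp add: pdiff_add[OF \<open>open S\<close>])
    show "Ck_bigo S r k (\<lambda>\<epsilon> p. pdiff e (F \<epsilon>) p + pdiff e (G \<epsilon>) p)"
      using Suc that by (simp add: Ck_bigo_Suc)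
  qed
  moreover have "Ck_bigo S r k (\<lambda>\<epsilon> p. F \<epsilon> p + G \<epsilon> p)"
    by (intro Suc.IH Suc.prems[THEN Ck_bigo_SucD])
  ultimately show ?case using Ck_bigo_Suc Ck_bigo_0 by blast
qed

lemma Ck_bigo_bounded_linear:
  assumes "open S" "bounded_linear h" "Ck_bigo S r k F"
  shows "Ck_bigo S r k (\<lambda>\<epsilon> p. h (F \<epsilon> p))"
  using assms(3)
proof (induction k arbitrary: F)
  case 0
  then obtain K where
    F: "\<forall>\<^sub>F \<epsilon> in at_right 0. F \<epsilon> differentiable_on S \<and> (\<forall>p\<in>S. norm (F \<epsilon> p) \<le> K * \<bar>r \<epsilon>\<bar>)" by auto
  obtain L where L: "L \<ge> 0" "\<And>x. norm (h x) \<le> norm x * L"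
    using bounded_linear.nonneg_bounded[OF assms(2)] by blast
  from F have "\<forall>\<^sub>F \<epsilon> in at_right 0. (\<lambda>p. h (F \<epsilon> p)) differentiable_on S
      \<and> (\<forall>p\<in>S. norm (h (F \<epsilon> p)) \<le> (K * L) * \<bar>r \<epsilon>\<bar>)"
  proof eventually_elim
    case (elim \<epsilon>)
    have "norm (h (F \<epsilon> p)) \<le> (K * L) * \<bar>r \<epsilon>\<bar>" if "p \<in> S" for p
    proof -
      have "norm (h (F \<epsilon> p)) \<le> norm (F \<epsilon> p) * L" by (rule L)
      also have "\<dots> \<le> (K * \<bar>r \<epsilon>\<bar>) * L" using elim that L by (intro mult_right_mono) auto
      finally show ?thesis by (simp add: mult_ac)
    qed
    with elim show ?case using differentiable_on_bounded_linear[OF assms(2)] by blast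
  qed
  then show ?case unfolding Ck_bigo.simps by blast
next
  case (Suc k)
  have "Ck_bigo S r k (\<lambda>\<epsilon>. pdiff e (\<lambda>p. h (F \<epsilon> p)))" if "e \<in> Basis" for e
  proof (rule Ck_bigo_cong[OF \<open>open S\<close>])
    show "\<forall>\<^sub>F \<epsilon> in at_right 0. \<forall>p\<in>S. h (pdiff e (F \<epsilon>) p) = pdiff e (\<lambda>p. h (F \<epsilon> p)) p"
      using Suc.prems[THEN Ck_bigo_differentiable]
      by eventually_elim (simp add: pdiff_bounded_linear[OF assms(2,1)])
    show "Ck_bigo S r k (\<lambda>\<epsilon> p. h (pdiff e (F \<epsilon>) p))"
      using Suc that by (simp add: Ck_bigo_Suc)
  qed
  moreover have "Ck_bigo S r k (\<lambda>\<epsilon> p. h (F \<epsilon> p))"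
    by (intro Suc.IH Suc.prems[THEN Ck_bigo_SucD])
  ultimately show ?case using Ck_bigo_Suc Ck_bigo_0 by blast
qed

lemma Ck_bigo_bilinear:
  assumes "open S" "bounded_bilinear h" "Ck_bigo S r k F" "Ck_bigo S s k G"
  shows "Ck_bigo S (\<lambda>\<epsilon>. r \<epsilon> * s \<epsilon>) k (\<lambda>\<epsilon> p. h (F \<epsilon> p) (G \<epsilon> p))"
  using assms(3,4)
proof (induction k arbitrary: F G)
  case 0
  then obtain K M where
    FG: "\<forall>\<^sub>F \<epsilon> in at_right 0. F \<epsilon> differentiable_on S \<and> (\<forall>p\<in>S. norm (F \<epsilon> p) \<le> K * \<bar>r \<epsilon>\<bar>)"
    "\<forall>\<^sub>F \<epsilon> in at_right 0. G \<epsilon> differentiable_on S \<and> (\<forall>p\<in>S. norm (G \<epsilon> p) \<le> M * \<bar>s \<epsilon>\<bar>)" by auto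
  obtain L where L: "L \<ge> 0" "\<And>x y. norm (h x y) \<le> norm x * norm y * L"
    using bounded_bilinear.nonneg_bounded[OF assms(2)] by blast
  from FG have "\<forall>\<^sub>F \<epsilon> in at_right 0. (\<lambda>p. h (F \<epsilon> p) (G \<epsilon> p)) differentiable_on S
      \<and> (\<forall>p\<in>S. norm (h (F \<epsilon> p) (G \<epsilon> p)) \<le> (K * M * L) * \<bar>r \<epsilon> * s \<epsilon>\<bar>)"
  proof eventually_elim
    case (elim \<epsilon>)
    have "norm (h (F \<epsilon> p) (G \<epsilon> p)) \<le> (K * M * L) * \<bar>r \<epsilon> * s \<epsilon>\<bar>" if "p \<in> S" for p
    proof -
      have "norm (h (F \<epsilon> p) (G \<epsilon> p)) \<le> norm (F \<epsilon> p) * norm (G \<epsilon> p) * L" by (rule L)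
      also have "\<dots> \<le> (K * \<bar>r \<epsilon>\<bar>) * (M * \<bar>s \<epsilon>\<bar>) * L" using elim that L
        by (intro mult_right_mono mult_mono) (auto intro: order_trans[OF norm_ge_zero])
      finally show ?thesis by (simp add: mult_ac abs_mult)
    qed
    with elim show ?case using differentiable_on_bilinear[OF assms(2)] by blast
  qed
  then show ?case unfolding Ck_bigo.simps by blast
next
  case (Suc k)
  have "Ck_bigo S (\<lambda>\<epsilon>. r \<epsilon> * s \<epsilon>) k (\<lambda>\<epsilon>. pdiff e (\<lambda>p. h (F \<epsilon> p) (G \<epsilon> p)))" if "e \<in> Basis" for e
  proof (rule Ck_bigo_cong[OF \<open>open S\<close>])
    show "\<forall>\<^sub>F \<epsilon> in at_right 0. \<forall>p\<in>S. h (pdiff e (F \<epsilon>) p) (G \<epsilon> p) + h (F \<epsilon> p) (pdiff e (G \<epsilon>) p)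
        = pdiff e (\<lambda>p. h (F \<epsilon> p) (G \<epsilon> p)) p"
      using Suc.prems[THEN Ck_bigo_differentiable]
      by eventually_elim (simp add: pdiff_bilinear[OF assms(2,1)])
    show "Ck_bigo S (\<lambda>\<epsilon>. r \<epsilon> * s \<epsilon>) k (\<lambda>\<epsilon> p. h (pdiff e (F \<epsilon>) p) (G \<epsilon> p) + h (F \<epsilon> p) (pdiff e (G \<epsilon>) p))"
      using Suc.prems[THEN Ck_bigo_SucD] Suc.prems[unfolded Ck_bigo_Suc] that
      by (intro Ck_bigo_add Suc.IH \<open>open S\<close>) blast+
  qed
  moreover have "Ck_bigo S (\<lambda>\<epsilon>. r \<epsilon> * s \<epsilon>) k (\<lambda>\<epsilon> p. h (F \<epsilon> p) (G \<epsilon> p))"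
    by (intro Suc.IH Suc.prems[THEN Ck_bigo_SucD])
  ultimately show ?case using Ck_bigo_Suc Ck_bigo_0 by blast
qed

text \<open>Coefficients that depend on \<open>\<epsilon>\<close> alone are families of constant functions.  Multiplying by them through
\<open>Ck_bigo_bilinear\<close> transfers their rate.\<close>

lemma Ck_bigo_const:
  assumes "c \<in> O[at_right 0](r)"
  shows "Ck_bigo S r k (\<lambda>\<epsilon> p. c \<epsilon> *\<^sub>R v)"
proof -
  have zero: "Ck_bigo S r k (\<lambda>\<epsilon> p. 0 :: 'b)" for k
    by (induction k) (auto simp: Ck_bigo_Suc intro!: exI[of _ 0])
  obtain K where "\<forall>\<^sub>F \<epsilon> in at_right 0. norm (c \<epsilon>) \<le> K * norm (r \<epsilon>)"
    using assms by (auto elim: landau_o.bigE)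
  then have "\<forall>\<^sub>F \<epsilon> in at_right 0. (\<lambda>p::'a. c \<epsilon> *\<^sub>R v) differentiable_on S \<and>
      (\<forall>p\<in>S. norm (c \<epsilon> *\<^sub>R v) \<le> (K * norm v) * \<bar>r \<epsilon>\<bar>)"
  proof eventually_elim
    case (elim \<epsilon>)
    then have "norm (c \<epsilon> *\<^sub>R v) \<le> (K * \<bar>r \<epsilon>\<bar>) * norm v"
      by (auto intro: mult_right_mono)
    then show ?case by (simp add: mult_ac)
  qed
  then have "Ck_bigo S r 0 (\<lambda>\<epsilon> p. c \<epsilon> *\<^sub>R v)" unfolding Ck_bigo.simps by blast
  with zero show ?thesis by (cases k) (auto simp only: Ck_bigo_Suc pdiff_const)
qed

text \<open>The recursion peels the derivative applied first off the end of the list \<open>es\<close>, whereas \<^const>\<open>foldr\<close>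
peels the one applied last off its head; hence the induction over lists from the right.\<close>

lemma Ck_bigo_iff_partials:
  "Ck_bigo S r k F \<longleftrightarrow> (\<forall>es\<in>lists Basis. length es \<le> k \<longrightarrow>
     (\<exists>K. \<forall>\<^sub>F \<epsilon> in at_right 0. partials es (F \<epsilon>) differentiable_on S \<and>
        (\<forall>p\<in>S. norm (partials es (F \<epsilon>) p) \<le> K * \<bar>r \<epsilon>\<bar>)))"
  (is "_ \<longleftrightarrow> (\<forall>es\<in>_. _ \<longrightarrow> ?P es F)")
proof (induction k arbitrary: F)
  case 0 show ?case by auto
next
  case (Suc k)
  have "(\<forall>es\<in>lists Basis. length es \<le> Suc k \<longrightarrow> ?P es F) \<longleftrightarrow>
      ?P [] F \<and> (\<forall>e\<in>Basis. \<forall>es\<in>lists Basis. length es \<le> k \<longrightarrow> ?P (es @ [e]) F)" (is "?L = ?R")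
  proof
    assume ?R
    show ?L
    proof (intro ballI impI)
      fix es :: "'a list" assume es: "es \<in> lists Basis" "length es \<le> Suc k"
      show "?P es F"
      proof (cases es rule: rev_cases)
        case Nil with \<open>?R\<close> show ?thesis by simp
      next
        case (snoc es' e)
        with es have "e \<in> Basis" "es' \<in> lists Basis" "length es' \<le> k" by auto
        with \<open>?R\<close> show ?thesis unfolding snoc by blast
      qed
    qed
  next
    assume ?L
    show ?R
    proof (intro conjI ballI impI)
      show "?P [] F" using \<open>?L\<close>[rule_format, of "[]"] by simp
      fix e :: 'a and es :: "'a list"
      assume "e \<in> Basis" "es \<in> lists Basis" "length es \<le> k"
      then show "?P (es @ [e]) F" using \<open>?L\<close>[rule_format, of "es @ [e]"] by simp
    qed
  qed
  also have "\<dots> \<longleftrightarrow> Ck_bigo S r (Suc k) F"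
    by (simp add: Ck_bigo_Suc Suc.IH)
  finally show ?case by blast
qed

lemma Ck_bigo_mono:
  assumes "r \<in> O[at_right 0](s)" "Ck_bigo S r k F"
  shows "Ck_bigo S s k F"
  using assms(2)
proof (induction k arbitrary: F)
  case 0
  then obtain K where
    K: "\<forall>\<^sub>F \<epsilon> in at_right 0. F \<epsilon> differentiable_on S \<and> (\<forall>p\<in>S. norm (F \<epsilon> p) \<le> K * \<bar>r \<epsilon>\<bar>)" by auto
  obtain L where "L > 0" "\<forall>\<^sub>F \<epsilon> in at_right 0. norm (r \<epsilon>) \<le> L * norm (s \<epsilon>)"
    using assms(1) by (auto elim: landau_o.bigE)
  from this(2) K have "\<forall>\<^sub>F \<epsilon> in at_right 0. F \<epsilon> differentiable_on S \<and> (\<forall>p\<in>S. norm (F \<epsilon> p) \<le> (\<bar>K\<bar> * L) * \<bar>s \<epsilon>\<bar>)"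
  proof eventually_elim
    case (elim \<epsilon>)
    have "K * \<bar>r \<epsilon>\<bar> \<le> \<bar>K\<bar> * (L * \<bar>s \<epsilon>\<bar>)"
      using elim(1) by (intro mult_mono) auto
    with elim show ?case by (force simp: mult.assoc)
  qed
  then show ?case unfolding Ck_bigo.simps by blast
next
  case (Suc k)
  from Suc.IH[OF Suc.prems[THEN Ck_bigo_SucD]] have "Ck_bigo S s 0 F" by (rule Ck_bigo_0)
  with Suc show ?case by (simp add: Ck_bigo_Suc del: Ck_bigo.simps)
qed

section \<open>Smooth functions as constant families\<close>

lemma Ck_bigo_pdiff: "Ck_bigo S r (Suc k) F \<Longrightarrow> e \<in> Basis \<Longrightarrow> Ck_bigo S r k (\<lambda>\<epsilon>. pdiff e (F \<epsilon>))"
  by (simp add: Ck_bigo_Suc)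

text \<open>A single function is a family that does not depend on \<open>\<epsilon>\<close>, so the closure properties of smooth functions
are instances of those of families.\<close>

lemma smooth_bounded_iff_Ck_bigo:
  "smooth_bounded S f \<longleftrightarrow> (\<forall>k. Ck_bigo S (\<lambda>_. 1) k (\<lambda>_. f))"
proof -
  have *: "bounded (g ` S) \<longleftrightarrow> (\<exists>K. \<forall>p\<in>S. norm (g p) \<le> K)" for g :: "'a \<Rightarrow> 'b"
    by (auto simp: bounded_iff)
  show ?thesis
    unfolding smooth_bounded_def Ck_bigo_iff_partials * by (simp add: eventually_const) blast
qed

lemma smooth_bounded_differentiable: "smooth_bounded S f \<Longrightarrow> f differentiable_on S"
  unfolding smooth_bounded_def by (metis foldr.simps(1) id_apply lists.Nil)

lemma smooth_bounded_bounded: "smooth_bounded S f \<Longrightarrow> \<exists>M. \<forall>p\<in>S. norm (f p) \<le> M"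
  unfolding smooth_bounded_def bounded_iff by (metis foldr.simps(1) id_apply image_eqI lists.Nil)

lemma smooth_bounded_pdiff: "smooth_bounded S f \<Longrightarrow> e \<in> Basis \<Longrightarrow> smooth_bounded S (pdiff e f)"
  unfolding smooth_bounded_iff_Ck_bigo using Ck_bigo_pdiff[of S "\<lambda>_. 1" _ "\<lambda>_. f"] by simp

lemma smooth_bounded_cong:
  "open S \<Longrightarrow> smooth_bounded S f \<Longrightarrow> (\<And>p. p \<in> S \<Longrightarrow> f p = g p) \<Longrightarrow> smooth_bounded S g"
  unfolding smooth_bounded_iff_Ck_bigo
  using Ck_bigo_cong[of S "\<lambda>_. f" "\<lambda>_. g"] by auto

lemma smooth_bounded_add:
  "open S \<Longrightarrow> smooth_bounded S f \<Longrightarrow> smooth_bounded S g \<Longrightarrow> smooth_bounded S (\<lambda>p. f p + g p)"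
  unfolding smooth_bounded_iff_Ck_bigo using Ck_bigo_add[of S "\<lambda>_. 1" _ "\<lambda>_. f" "\<lambda>_. g"] by simp

lemma smooth_bounded_bounded_linear:
  "open S \<Longrightarrow> bounded_linear h \<Longrightarrow> smooth_bounded S f \<Longrightarrow> smooth_bounded S (\<lambda>p. h (f p))"
  unfolding smooth_bounded_iff_Ck_bigo
  using Ck_bigo_bounded_linear[of S h "\<lambda>_. 1" _ "\<lambda>_. f"] by simp

lemma smooth_bounded_bilinear:
  "open S \<Longrightarrow> bounded_bilinear h \<Longrightarrow> smooth_bounded S f \<Longrightarrow> smooth_bounded S g
    \<Longrightarrow> smooth_bounded S (\<lambda>p. h (f p) (g p))"
  unfolding smooth_bounded_iff_Ck_bigo
  using Ck_bigo_bilinear[of S h "\<lambda>_. 1" _ "\<lambda>_. f" "\<lambda>_. 1" "\<lambda>_. g"] by simp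

lemma smooth_bounded_const: "smooth_bounded S (\<lambda>p. c)"
  unfolding smooth_bounded_iff_Ck_bigo using Ck_bigo_const[of "\<lambda>_. 1" "\<lambda>_. 1" S _ c] by simp

lemma smooth_bounded_linear_map:
  assumes "open S" "bounded S" "bounded_linear h"
  shows "smooth_bounded S h"
proof -
  have "Ck_bigo S (\<lambda>_. 1) k (\<lambda>_. h)" for k
  proof -
    have "h differentiable_on S"
      using assms(3) bounded_linear_imp_differentiable_on by blast
    moreover obtain K where "\<forall>p\<in>S. norm (h p) \<le> K"
      using bounded_linear_image[OF assms(2,3)] by (auto simp: bounded_iff)
    ultimately have 0: "Ck_bigo S (\<lambda>_. 1) 0 (\<lambda>_. h)"
      by (auto simp: eventually_const)
    have "pdiff e h = (\<lambda>p. h e)" for e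
      using pdiff_eqI[OF bounded_linear_imp_has_derivative[OF assms(3)]] by auto
    with 0 show ?thesis
      using smooth_bounded_const[of S, unfolded smooth_bounded_iff_Ck_bigo]
      by (cases k) (auto simp only: Ck_bigo_Suc)
  qed
  then show ?thesis by (simp add: smooth_bounded_iff_Ck_bigo)
qed

section \<open>Smooth families\<close>

text \<open>The smoothness of all orders holds on one common range of \<open>\<epsilon>\<close>; in \<^const>\<open>Ck_bigo\<close> the range may shrink
as \<open>k\<close> grows.\<close>

definition bigo_family :: "'a::euclidean_space set \<Rightarrow> (real \<Rightarrow> real)
    \<Rightarrow> (real \<Rightarrow> 'a \<Rightarrow> 'b::real_normed_vector) \<Rightarrow> bool" where
  "bigo_family S r F \<longleftrightarrow>
     (\<forall>\<^sub>F \<epsilon> in at_right 0. smooth_bounded S (F \<epsilon>)) \<and> (\<forall>k. Ck_bigo S r k F)"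

lemma bigo_family_cong:
  assumes "open S" "bigo_family S r F" "\<forall>\<^sub>F \<epsilon> in at_right 0. \<forall>p\<in>S. F \<epsilon> p = G \<epsilon> p"
  shows "bigo_family S r G"
proof -
  have "\<forall>\<^sub>F \<epsilon> in at_right 0. smooth_bounded S (G \<epsilon>)"
    using assms(3) conjunct1[OF assms(2)[unfolded bigo_family_def]]
    by eventually_elim (blast intro: smooth_bounded_cong[OF \<open>open S\<close>])
  then show ?thesis using assms Ck_bigo_cong unfolding bigo_family_def by blast
qed

lemma bigo_family_mono: "r \<in> O[at_right 0](s) \<Longrightarrow> bigo_family S r F \<Longrightarrow> bigo_family S s F"
  unfolding bigo_family_def using Ck_bigo_mono by blast

lemma bigo_family_add:
  assumes "open S" "bigo_family S r F" "bigo_family S r G"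
  shows "bigo_family S r (\<lambda>\<epsilon> p. F \<epsilon> p + G \<epsilon> p)"
proof -
  have "\<forall>\<^sub>F \<epsilon> in at_right 0. smooth_bounded S (F \<epsilon>)" "\<forall>\<^sub>F \<epsilon> in at_right 0. smooth_bounded S (G \<epsilon>)"
    using assms unfolding bigo_family_def by auto
  then have "\<forall>\<^sub>F \<epsilon> in at_right 0. smooth_bounded S (\<lambda>p. F \<epsilon> p + G \<epsilon> p)"
    by eventually_elim (rule smooth_bounded_add[OF assms(1)])
  then show ?thesis using assms Ck_bigo_add unfolding bigo_family_def by blast
qed

lemma bigo_family_bounded_linear:
  assumes "open S" "bounded_linear h" "bigo_family S r F"
  shows "bigo_family S r (\<lambda>\<epsilon> p. h (F \<epsilon> p))"
  using assms(3) Ck_bigo_bounded_linear[OF assms(1,2)] smooth_bounded_bounded_linear[OF assms(1,2)]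
  unfolding bigo_family_def by (auto elim!: eventually_mono)

lemma bigo_family_bilinear:
  assumes "open S" "bounded_bilinear h" "bigo_family S r F" "bigo_family S s G"
  shows "bigo_family S (\<lambda>\<epsilon>. r \<epsilon> * s \<epsilon>) (\<lambda>\<epsilon> p. h (F \<epsilon> p) (G \<epsilon> p))"
proof -
  have "\<forall>\<^sub>F \<epsilon> in at_right 0. smooth_bounded S (F \<epsilon>)" "\<forall>\<^sub>F \<epsilon> in at_right 0. smooth_bounded S (G \<epsilon>)"
    using assms unfolding bigo_family_def by auto
  then have "\<forall>\<^sub>F \<epsilon> in at_right 0. smooth_bounded S (\<lambda>p. h (F \<epsilon> p) (G \<epsilon> p))"
    by eventually_elim (rule smooth_bounded_bilinear[OF assms(1,2)])
  then show ?thesis using assms Ck_bigo_bilinear unfolding bigo_family_def by blast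
qed

lemma bigo_family_pdiff:
  "bigo_family S r F \<Longrightarrow> e \<in> Basis \<Longrightarrow> bigo_family S r (\<lambda>\<epsilon>. pdiff e (F \<epsilon>))"
  unfolding bigo_family_def
  by (auto intro: smooth_bounded_pdiff Ck_bigo_pdiff elim!: eventually_mono)

lemma bigo_family_const:
  "c \<in> O[at_right 0](r) \<Longrightarrow> bigo_family S r (\<lambda>\<epsilon> p. c \<epsilon> *\<^sub>R v)"
  unfolding bigo_family_def by (simp add: Ck_bigo_const smooth_bounded_const)

lemma bigo_family_fixed: "smooth_bounded S f \<Longrightarrow> bigo_family S (\<lambda>_. 1) (\<lambda>_. f)"
  unfolding bigo_family_def by (auto simp: smooth_bounded_iff_Ck_bigo)

lemma bigo_family_bounded:
  assumes "bigo_family S r F"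
  shows "\<exists>K>0. \<forall>\<^sub>F \<epsilon> in at_right 0. \<forall>p\<in>S. norm (F \<epsilon> p) \<le> K * \<bar>r \<epsilon>\<bar>"
proof -
  obtain K where K: "\<forall>\<^sub>F \<epsilon> in at_right 0. \<forall>p\<in>S. norm (F \<epsilon> p) \<le> K * \<bar>r \<epsilon>\<bar>"
    using Ck_bigo.simps(1)[of S r F] assms unfolding bigo_family_def
    by (metis (mono_tags, lifting) eventually_mono)
  have "K * \<bar>r \<epsilon>\<bar> \<le> (\<bar>K\<bar> + 1) * \<bar>r \<epsilon>\<bar>" for \<epsilon>
    by (intro mult_right_mono) auto
  with K have "\<forall>\<^sub>F \<epsilon> in at_right 0. \<forall>p\<in>S. norm (F \<epsilon> p) \<le> (\<bar>K\<bar> + 1) * \<bar>r \<epsilon>\<bar>"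
    by (elim eventually_mono) (meson order_trans)
  then show ?thesis by (intro exI[of _ "\<bar>K\<bar> + 1"]) auto
qed

lemma bigo_family_diff:
  assumes "open S" "bigo_family S r F" "bigo_family S r G"
  shows "bigo_family S r (\<lambda>\<epsilon> p. F \<epsilon> p - G \<epsilon> p)"
  using bigo_family_add[OF assms(1,2) bigo_family_bounded_linear[OF assms(1) bounded_linear_minus[OF bounded_linear_ident] assms(3)]]
  by simp

lemma smooth_bounded_diff:
  assumes "open S" "smooth_bounded S f" "smooth_bounded S g"
  shows "smooth_bounded S (\<lambda>p. f p - g p)"
  using smooth_bounded_add[OF assms(1,2) smooth_bounded_bounded_linear[OF assms(1) bounded_linear_minus[OF bounded_linear_ident] assms(3)]]
  by simp

section \<open>The \<open>C\<^sup>k\<close> norms\<close>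

lemma finite_multi_indices: "finite {es \<in> lists (Basis :: 'a::euclidean_space set). length es \<le> k}"
  using finite_lists_length_le[OF finite_Basis, of k] by (simp add: in_lists_conv_set subset_iff Ball_def)

lemma bdd_above_Ck_norm:
  assumes "smooth_bounded S f"
  shows "bdd_above {norm (partials es f p) | es p. es \<in> lists Basis \<and> length es \<le> k \<and> p \<in> S}"
proof -
  have "\<forall>es\<in>{es \<in> lists Basis. length es \<le> k}. \<exists>M. \<forall>p\<in>S. norm (partials es f p) \<le> M"
    using assms unfolding smooth_bounded_def bounded_iff by auto
  from bchoice[OF this] obtain M where M: "\<And>es p. es \<in> lists Basis \<Longrightarrow> length es \<le> k \<Longrightarrow> p \<in> S \<Longrightarrow> norm (partials es f p) \<le> M es"
    by auto
  have "M es \<le> Max (M ` {es \<in> lists Basis. length es \<le> k})" if "es \<in> lists Basis" "length es \<le> k" for es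
    using that by (intro Max_ge finite_imageI finite_multi_indices) auto
  then show ?thesis
    by (intro bdd_aboveI[of _ "Max (M ` {es \<in> lists Basis. length es \<le> k})"])
      (auto intro: order_trans[OF M])
qed

lemma norm_partials_le_Ck_norm:
  "smooth_bounded S f \<Longrightarrow> es \<in> lists Basis \<Longrightarrow> length es \<le> k \<Longrightarrow> p \<in> S \<Longrightarrow> norm (partials es f p) \<le> Ck_norm S k f"
  unfolding Ck_norm_def by (intro cSup_upper bdd_above_Ck_norm) blast+

lemma Ck_norm_leI:
  assumes "S \<noteq> {}" "\<And>es p. es \<in> lists Basis \<Longrightarrow> length es \<le> k \<Longrightarrow> p \<in> S \<Longrightarrow> norm (partials es f p) \<le> c"
  shows "Ck_norm S k f \<le> c"
proof -
  have "[] \<in> lists (Basis :: 'a set)" "length [] \<le> k" by auto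
  then show ?thesis
    unfolding Ck_norm_def using assms by (intro cSup_least) blast+
qed

lemma Ck_norm_nonneg: "smooth_bounded S f \<Longrightarrow> S \<noteq> {} \<Longrightarrow> 0 \<le> Ck_norm S k f"
proof -
  assume "smooth_bounded S f" "S \<noteq> {}"
  then obtain p where "p \<in> S" by blast
  with \<open>smooth_bounded S f\<close> have "norm (f p) \<le> Ck_norm S k f"
    using norm_partials_le_Ck_norm[of S f "[]" k p] by simp
  then show ?thesis using norm_ge_zero order_trans by blast
qed

lemma Ck_norm_cong:
  assumes "open S" "\<And>p. p \<in> S \<Longrightarrow> f p = g p"
  shows "Ck_norm S k f = Ck_norm S k g"
proof -
  have "partials es f p = partials es g p" if "p \<in> S" for es p
    by (rule partials_cong[OF assms(1) that assms(2)])
  then show ?thesis unfolding Ck_norm_def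
    by (intro arg_cong[where f = Sup] Collect_cong ex_cong1) auto
qed

text \<open>Only finitely many multi-indices have length at most \<open>k\<close>, so the constants and the ranges of \<open>\<epsilon>\<close> of the
separate derivatives can be made uniform.\<close>

lemma Ck_bigo_iff_Ck_norm:
  assumes "S \<noteq> {}" "\<forall>\<^sub>F \<epsilon> in at_right 0. smooth_bounded S (F \<epsilon>)"
  shows "Ck_bigo S r k F \<longleftrightarrow> (\<lambda>\<epsilon>. Ck_norm S k (F \<epsilon>)) \<in> O[at_right 0](r)"
proof
  assume "Ck_bigo S r k F"
  then have "\<forall>es\<in>{es \<in> lists Basis. length es \<le> k}. \<exists>K. \<forall>\<^sub>F \<epsilon> in at_right 0.
      \<forall>p\<in>S. norm (partials es (F \<epsilon>) p) \<le> K * \<bar>r \<epsilon>\<bar>"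
    unfolding Ck_bigo_iff_partials by (auto elim!: eventually_mono dest!: bspec)
  from bchoice[OF this] obtain K where K: "\<And>es. es \<in> lists Basis \<Longrightarrow> length es \<le> k \<Longrightarrow>
      \<forall>\<^sub>F \<epsilon> in at_right 0. \<forall>p\<in>S. norm (partials es (F \<epsilon>) p) \<le> K es * \<bar>r \<epsilon>\<bar>"
    by auto
  define L where "L = Max (K ` {es \<in> lists Basis. length es \<le> k})"
  have KL: "K es \<le> L" if "es \<in> lists Basis" "length es \<le> k" for es
    unfolding L_def using that by (intro Max_ge finite_imageI finite_multi_indices) auto
  have "\<forall>\<^sub>F \<epsilon> in at_right 0. \<forall>es\<in>{es \<in> lists Basis. length es \<le> k}.
      \<forall>p\<in>S. norm (partials es (F \<epsilon>) p) \<le> K es * \<bar>r \<epsilon>\<bar>"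
    by (intro eventually_ball_finite finite_multi_indices) (use K in auto)
  then have "\<forall>\<^sub>F \<epsilon> in at_right 0. norm (Ck_norm S k (F \<epsilon>)) \<le> L * norm (r \<epsilon>)"
    using assms(2)
  proof eventually_elim
    case (elim \<epsilon>)
    have "Ck_norm S k (F \<epsilon>) \<le> L * \<bar>r \<epsilon>\<bar>"
    proof (rule Ck_norm_leI[OF assms(1)])
      fix es :: "'a list" and p assume *: "es \<in> lists Basis" "length es \<le> k" "p \<in> S"
      then have "norm (partials es (F \<epsilon>) p) \<le> K es * \<bar>r \<epsilon>\<bar>" using elim by auto
      also have "\<dots> \<le> L * \<bar>r \<epsilon>\<bar>" using KL * by (intro mult_right_mono) auto
      finally show "norm (partials es (F \<epsilon>) p) \<le> L * \<bar>r \<epsilon>\<bar>" .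
    qed
    with Ck_norm_nonneg[OF elim(2) assms(1)] show ?case by simp
  qed
  then show "(\<lambda>\<epsilon>. Ck_norm S k (F \<epsilon>)) \<in> O[at_right 0](r)" by (rule bigoI)
next
  assume "(\<lambda>\<epsilon>. Ck_norm S k (F \<epsilon>)) \<in> O[at_right 0](r)"
  then obtain K where K: "\<forall>\<^sub>F \<epsilon> in at_right 0. norm (Ck_norm S k (F \<epsilon>)) \<le> K * norm (r \<epsilon>)"
    by (auto elim: landau_o.bigE)
  show "Ck_bigo S r k F"
    unfolding Ck_bigo_iff_partials
  proof (intro ballI impI exI)
    fix es :: "'a list" assume es: "es \<in> lists Basis" "length es \<le> k"
    show "\<forall>\<^sub>F \<epsilon> in at_right 0. partials es (F \<epsilon>) differentiable_on S \<and>
        (\<forall>p\<in>S. norm (partials es (F \<epsilon>) p) \<le> K * \<bar>r \<epsilon>\<bar>)"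
      using K assms(2)
    proof eventually_elim
      case (elim \<epsilon>)
      show ?case
        using norm_partials_le_Ck_norm[OF elim(2) es] elim es
        unfolding smooth_bounded_def by force
    qed
  qed
qed

section \<open>Calculus of expansions\<close>

lemma expands_iff_bigo_family:
  assumes "open S" "S \<noteq> {}"
  shows "expands S F F0 \<longleftrightarrow> smooth_bounded S F0 \<and> bigo_family S (\<lambda>\<epsilon>. \<epsilon>) (\<lambda>\<epsilon> p. F \<epsilon> p - F0 p)"
proof (cases "smooth_bounded S F0")
  case True
  have "smooth_bounded S (\<lambda>p. F \<epsilon> p - F0 p) \<longleftrightarrow> smooth_bounded S (F \<epsilon>)" for \<epsilon>
    using smooth_bounded_diff[OF assms(1) _ True] smooth_bounded_add[OF assms(1) _ True]
    by force
  then show ?thesis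
    using True Ck_bigo_iff_Ck_norm[OF assms(2), of "\<lambda>\<epsilon> p. F \<epsilon> p - F0 p" "\<lambda>\<epsilon>. \<epsilon>"]
    unfolding expands_def bigo_family_def by auto
qed (simp add: expands_def)

lemma identity_bigo_1: "(\<lambda>\<epsilon> :: real. \<epsilon>) \<in> O[at_right 0](\<lambda>_. 1 :: real)"
proof (rule bigoI[of _ 1])
  show "\<forall>\<^sub>F \<epsilon> in at_right (0::real). norm \<epsilon> \<le> 1 * norm (1::real)"
    using eventually_at_right_real[OF zero_less_one] by (rule eventually_mono) auto
qed

lemma expands_bigo_1:
  assumes "open S" "S \<noteq> {}" "expands S F F0"
  shows "bigo_family S (\<lambda>_. 1) F"
proof -
  have "bigo_family S (\<lambda>_. 1) (\<lambda>\<epsilon> p. (F \<epsilon> p - F0 p) + F0 p)"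
    using assms bigo_family_mono[OF identity_bigo_1]
    by (intro bigo_family_add bigo_family_fixed) (auto simp: expands_iff_bigo_family)
  then show ?thesis by simp
qed

context
  fixes S :: "'a::euclidean_space set"
  assumes S: "open S" "S \<noteq> {}"
begin

lemma expands_cong:
  assumes "expands S F F0" "\<forall>\<^sub>F \<epsilon> in at_right 0. \<forall>p\<in>S. F \<epsilon> p = G \<epsilon> p" "\<And>p. p \<in> S \<Longrightarrow> F0 p = G0 p"
  shows "expands S G G0"
  unfolding expands_iff_bigo_family[OF S]
proof
  show "smooth_bounded S G0"
    using assms(1,3) smooth_bounded_cong[OF S(1)] unfolding expands_def by blast
  have "bigo_family S (\<lambda>\<epsilon>. \<epsilon>) (\<lambda>\<epsilon> p. F \<epsilon> p - F0 p)"
    using assms(1) unfolding expands_iff_bigo_family[OF S] by blast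
  then show "bigo_family S (\<lambda>\<epsilon>. \<epsilon>) (\<lambda>\<epsilon> p. G \<epsilon> p - G0 p)"
  proof (rule bigo_family_cong[OF S(1)])
    show "\<forall>\<^sub>F \<epsilon> in at_right 0. \<forall>p\<in>S. F \<epsilon> p - F0 p = G \<epsilon> p - G0 p"
      using assms(2) by eventually_elim (use assms(3) in simp)
  qed
qed

lemma expands_add:
  assumes "expands S F F0" "expands S G G0"
  shows "expands S (\<lambda>\<epsilon> p. F \<epsilon> p + G \<epsilon> p) (\<lambda>p. F0 p + G0 p)"
proof -
  have "bigo_family S (\<lambda>\<epsilon>. \<epsilon>) (\<lambda>\<epsilon> p. (F \<epsilon> p - F0 p) + (G \<epsilon> p - G0 p))"
    using assms unfolding expands_iff_bigo_family[OF S]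
    by (intro bigo_family_add S) auto
  moreover have "smooth_bounded S (\<lambda>p. F0 p + G0 p)"
    using assms unfolding expands_iff_bigo_family[OF S] by (intro smooth_bounded_add S) auto
  ultimately show ?thesis
    unfolding expands_iff_bigo_family[OF S] by (simp add: algebra_simps)
qed

lemma expands_bounded_linear:
  assumes "bounded_linear h" "expands S F F0"
  shows "expands S (\<lambda>\<epsilon> p. h (F \<epsilon> p)) (\<lambda>p. h (F0 p))"
proof -
  have "bigo_family S (\<lambda>\<epsilon>. \<epsilon>) (\<lambda>\<epsilon> p. h (F \<epsilon> p - F0 p))"
    using assms unfolding expands_iff_bigo_family[OF S]
    by (intro bigo_family_bounded_linear[OF S(1) assms(1)]) simp
  then show ?thesis
    using assms(2) smooth_bounded_bounded_linear[OF S(1) assms(1), of F0] unfolding expands_iff_bigo_family[OF S]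
    by (simp add: linear_diff[OF bounded_linear.linear[OF assms(1)]])
qed

lemma expands_diff:
  assumes "expands S F F0" "expands S G G0"
  shows "expands S (\<lambda>\<epsilon> p. F \<epsilon> p - G \<epsilon> p) (\<lambda>p. F0 p - G0 p)"
  using expands_add[OF assms(1) expands_bounded_linear[OF bounded_linear_minus[OF bounded_linear_ident] assms(2)]]
  by simp

text \<open>The remainder of a product is \<open>h (F - F0) G + h F0 (G - G0)\<close>, where each term has one small and one
bounded factor.\<close>

lemma expands_bilinear:
  assumes "bounded_bilinear h" "expands S F F0" "expands S G G0"
  shows "expands S (\<lambda>\<epsilon> p. h (F \<epsilon> p) (G \<epsilon> p)) (\<lambda>p. h (F0 p) (G0 p))"
proof -
  interpret h: bounded_bilinear h by fact
  have FG: "bigo_family S (\<lambda>\<epsilon>. \<epsilon>) (\<lambda>\<epsilon> p. F \<epsilon> p - F0 p)" "bigo_family S (\<lambda>\<epsilon>. \<epsilon>) (\<lambda>\<epsilon> p. G \<epsilon> p - G0 p)"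
    "smooth_bounded S F0" "smooth_bounded S G0"
    using assms unfolding expands_iff_bigo_family[OF S] by auto
  have "bigo_family S (\<lambda>\<epsilon>. \<epsilon> * 1) (\<lambda>\<epsilon> p. h (F \<epsilon> p - F0 p) (G \<epsilon> p))"
    by (rule bigo_family_bilinear[OF S(1) assms(1) FG(1) expands_bigo_1[OF S assms(3)]])
  moreover have "bigo_family S (\<lambda>\<epsilon>. 1 * \<epsilon>) (\<lambda>\<epsilon> p. h (F0 p) (G \<epsilon> p - G0 p))"
    by (rule bigo_family_bilinear[OF S(1) assms(1) bigo_family_fixed[OF FG(3)] FG(2)])
  ultimately have "bigo_family S (\<lambda>\<epsilon>. \<epsilon>)
      (\<lambda>\<epsilon> p. h (F \<epsilon> p - F0 p) (G \<epsilon> p) + h (F0 p) (G \<epsilon> p - G0 p))"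
    by (intro bigo_family_add S) simp_all
  then show ?thesis
    using smooth_bounded_bilinear[OF S(1) assms(1) FG(3,4)] unfolding expands_iff_bigo_family[OF S]
    by (simp add: h.diff_left h.diff_right)
qed

lemma expands_pdiff:
  assumes "e \<in> Basis" "expands S F F0"
  shows "expands S (\<lambda>\<epsilon>. pdiff e (F \<epsilon>)) (pdiff e F0)"
proof -
  have FG: "bigo_family S (\<lambda>\<epsilon>. \<epsilon>) (\<lambda>\<epsilon> p. F \<epsilon> p - F0 p)" "smooth_bounded S F0"
     "\<forall>\<^sub>F \<epsilon> in at_right 0. smooth_bounded S (F \<epsilon>)"
    using assms unfolding expands_iff_bigo_family[OF S] by (auto simp: assms(2)[unfolded expands_def])
  have *: "pdiff e (\<lambda>p. f p - g p) p = pdiff e f p - pdiff e g p"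
    if "f differentiable_on S" "g differentiable_on S" "p \<in> S" for f g :: "'a \<Rightarrow> 'b" and p
    using pdiff_add[of S "\<lambda>p. f p - g p" g p e] that S differentiable_on_diff by auto
  have "bigo_family S (\<lambda>\<epsilon>. \<epsilon>) (\<lambda>\<epsilon> p. pdiff e (F \<epsilon>) p - pdiff e F0 p)"
    using bigo_family_pdiff[OF FG(1) assms(1)]
  proof (rule bigo_family_cong[OF S(1)])
    show "\<forall>\<^sub>F \<epsilon> in at_right 0. \<forall>p\<in>S. pdiff e (\<lambda>p. F \<epsilon> p - F0 p) p = pdiff e (F \<epsilon>) p - pdiff e F0 p"
      using FG(3) by eventually_elim (use FG(2) * smooth_bounded_differentiable in blast)
  qed
  then show ?thesis
    using FG smooth_bounded_pdiff assms unfolding expands_iff_bigo_family[OF S] by blast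
qed

lemma expands_fixed: "smooth_bounded S f \<Longrightarrow> expands S (\<lambda>_. f) f"
  using bigo_family_const[of "\<lambda>_. 0" "\<lambda>\<epsilon>. \<epsilon>" S 0] unfolding expands_iff_bigo_family[OF S] by simp

lemma expands_const: "expands S (\<lambda>_ _. c) (\<lambda>_. c)"
  by (rule expands_fixed[OF smooth_bounded_const])

lemma expands_coeff:
  "(\<lambda>\<epsilon>. c \<epsilon> - c0) \<in> O[at_right 0](\<lambda>\<epsilon>. \<epsilon>) \<Longrightarrow> expands S (\<lambda>\<epsilon> _. c \<epsilon>) (\<lambda>_. c0)"
  using bigo_family_const[of "\<lambda>\<epsilon>. c \<epsilon> - c0" "\<lambda>\<epsilon>. \<epsilon>" S "1 :: real"]
  unfolding expands_iff_bigo_family[OF S] by (simp add: smooth_bounded_const)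

text \<open>This applies to families whose limit is not known to exist yet, such as the solutions of the elliptic
equation before \<open>elliptic_limit\<close> is established.\<close>

lemma expands_vanishing:
  assumes "c \<in> O[at_right 0](\<lambda>\<epsilon>. \<epsilon>)" "bigo_family S (\<lambda>_. 1) F"
  shows "expands S (\<lambda>\<epsilon> p. c \<epsilon> *\<^sub>R F \<epsilon> p) (\<lambda>_. 0)"
  using bigo_family_bilinear[OF S(1) bounded_bilinear_scaleR bigo_family_const[OF assms(1), of S 1] assms(2)]
  unfolding expands_iff_bigo_family[OF S] by (simp add: smooth_bounded_const)

lemma expands_unique:
  assumes "expands S F F0" "expands S F G0" "p \<in> S"
  shows "F0 p = G0 p"
proof -
  have FG: "bigo_family S (\<lambda>\<epsilon>. \<epsilon>) (\<lambda>\<epsilon> p. F \<epsilon> p - F0 p)" "bigo_family S (\<lambda>\<epsilon>. \<epsilon>) (\<lambda>\<epsilon> p. F \<epsilon> p - G0 p)"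
    using assms unfolding expands_iff_bigo_family[OF S] by auto
  obtain K L where KL:
    "\<forall>\<^sub>F \<epsilon> in at_right 0. \<forall>p\<in>S. norm (F \<epsilon> p - F0 p) \<le> K * \<bar>\<epsilon>\<bar>"
    "\<forall>\<^sub>F \<epsilon> in at_right 0. \<forall>p\<in>S. norm (F \<epsilon> p - G0 p) \<le> L * \<bar>\<epsilon>\<bar>"
    using bigo_family_bounded[OF FG(1)] bigo_family_bounded[OF FG(2)] by blast
  have "((\<lambda>\<epsilon>. (K + L) * \<bar>\<epsilon>\<bar>) \<longlongrightarrow> (K + L) * \<bar>0\<bar>) (at_right 0)"
    by (intro tendsto_intros)
  moreover have "\<forall>\<^sub>F \<epsilon> in at_right 0. norm (F0 p - G0 p) \<le> (K + L) * \<bar>\<epsilon>\<bar>"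
    using KL
  proof eventually_elim
    case (elim \<epsilon>)
    have "norm (F0 p - G0 p) \<le> norm (F \<epsilon> p - F0 p) + norm (F \<epsilon> p - G0 p)"
      using norm_triangle_ineq4[of "F \<epsilon> p - G0 p" "F \<epsilon> p - F0 p"] by simp
    also have "\<dots> \<le> K * \<bar>\<epsilon>\<bar> + L * \<bar>\<epsilon>\<bar>" using elim assms(3) by (intro add_mono) auto
    finally show ?case by (simp add: distrib_right)
  qed
  ultimately have "norm (F0 p - G0 p) \<le> (K + L) * \<bar>0\<bar>"
    by (intro tendsto_lowerbound) auto
  then show ?thesis by simp
qed

end

section \<open>Symmetry of second derivatives\<close>

lemma has_real_derivative_along_line:
  fixes f :: "'a::euclidean_space \<Rightarrow> real"
  assumes "open S" "f differentiable_on S" "q + s *\<^sub>R a \<in> S"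
  shows "((\<lambda>s. f (q + s *\<^sub>R a)) has_real_derivative pdiff a f (q + s *\<^sub>R a)) (at s)"
proof -
  let ?D = "frechet_derivative f (at (q + s *\<^sub>R a))"
  have D: "(f has_derivative ?D) (at (q + s *\<^sub>R a))"
    by (rule has_derivative_frechet) (use assms in auto)
  have "((\<lambda>s. f (q + s *\<^sub>R a)) has_derivative (\<lambda>h. ?D (h *\<^sub>R a))) (at s)"
    by (rule has_derivative_compose[where f = "\<lambda>s. q + s *\<^sub>R a" and g = f, OF _ D]) (auto intro!: derivative_eq_intros)
  moreover have "?D (h *\<^sub>R a) = pdiff a f (q + s *\<^sub>R a) * h" for h
    using linear_cmul[OF has_derivative_linear[OF D]] by (simp add: pdiff_def)
  ultimately show ?thesis by (simp add: has_field_derivative_def)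
qed

text \<open>The second difference over a parallelogram is the increment, along \<open>a\<close>, of the first difference along
\<open>b\<close>.  One mean value theorem in each direction turns it into a mixed derivative at an inner point.\<close>

lemma second_difference_MVT:
  fixes f :: "'a::euclidean_space \<Rightarrow> real"
  assumes "open S" "f differentiable_on S" "pdiff a f differentiable_on S" "h > 0"
    and par: "\<And>s t. 0 \<le> s \<Longrightarrow> s \<le> h \<Longrightarrow> 0 \<le> t \<Longrightarrow> t \<le> h \<Longrightarrow> p + s *\<^sub>R a + t *\<^sub>R b \<in> S"
  shows "\<exists>s\<in>{0..h}. \<exists>t\<in>{0..h}. f (p + h *\<^sub>R a + h *\<^sub>R b) - f (p + h *\<^sub>R a) - f (p + h *\<^sub>R b) + f p
           = h\<^sup>2 * pdiff b (pdiff a f) (p + s *\<^sub>R a + t *\<^sub>R b)"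
proof -
  have par0: "p + s *\<^sub>R a \<in> S" if "0 \<le> s" "s \<le> h" for s
    using par[OF that, of 0] \<open>h > 0\<close> by simp
  have "((\<lambda>s. f ((p + h *\<^sub>R b) + s *\<^sub>R a) - f (p + s *\<^sub>R a)) has_real_derivative
          pdiff a f ((p + h *\<^sub>R b) + s *\<^sub>R a) - pdiff a f (p + s *\<^sub>R a)) (at s)" if "0 \<le> s" "s \<le> h" for s
    using par[OF that, of h] par0[OF that] assms
    by (intro DERIV_diff has_real_derivative_along_line) (auto simp: add_ac)
  from MVT2[OF \<open>h > 0\<close> this] obtain s where s: "0 < s" "s < h" and
    1: "f ((p + h *\<^sub>R b) + h *\<^sub>R a) - f (p + h *\<^sub>R a) - (f (p + h *\<^sub>R b) - f p)
       = h * (pdiff a f ((p + h *\<^sub>R b) + s *\<^sub>R a) - pdiff a f (p + s *\<^sub>R a))"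
    by auto
  have "((\<lambda>t. pdiff a f ((p + s *\<^sub>R a) + t *\<^sub>R b)) has_real_derivative
          pdiff b (pdiff a f) ((p + s *\<^sub>R a) + t *\<^sub>R b)) (at t)" if "0 \<le> t" "t \<le> h" for t
    using par[OF _ _ that, of s] s assms by (intro has_real_derivative_along_line) auto
  from MVT2[OF \<open>h > 0\<close> this] obtain t where t: "0 < t" "t < h" and
    2: "pdiff a f ((p + s *\<^sub>R a) + h *\<^sub>R b) - pdiff a f (p + s *\<^sub>R a)
       = h * pdiff b (pdiff a f) ((p + s *\<^sub>R a) + t *\<^sub>R b)"
    by auto
  show ?thesis
  proof (rule bexI[of _ s], rule bexI[of _ t])
    show "f (p + h *\<^sub>R a + h *\<^sub>R b) - f (p + h *\<^sub>R a) - f (p + h *\<^sub>R b) + f p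
           = h\<^sup>2 * pdiff b (pdiff a f) (p + s *\<^sub>R a + t *\<^sub>R b)"
      using 1 2 by (simp add: power2_eq_square add_ac)
  qed (use s t in auto)
qed

text \<open>The second difference is symmetric in \<open>a\<close> and \<open>b\<close>, so \<open>second_difference_MVT\<close> gives equal values of the
two mixed derivatives at two points of the same small parallelogram; continuity does the rest.\<close>

lemma mixed_partials_commute:
  fixes f :: "'a::euclidean_space \<Rightarrow> real"
  assumes S: "open S" "p \<in> S"
    and f: "f differentiable_on S" "pdiff a f differentiable_on S" "pdiff b f differentiable_on S"
    and cont: "continuous_on S (pdiff b (pdiff a f))" "continuous_on S (pdiff a (pdiff b f))"
  shows "pdiff a (pdiff b f) p = pdiff b (pdiff a f) p"
proof (rule ccontr)
  let ?A = "pdiff b (pdiff a f)" and ?B = "pdiff a (pdiff b f)"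
  assume "?B p \<noteq> ?A p"
  define e where "e = \<bar>?A p - ?B p\<bar> / 2"
  have "e > 0" using \<open>?B p \<noteq> ?A p\<close> by (simp add: e_def)
  have "\<forall>\<^sub>F x in nhds p. x \<in> S \<and> dist (?A x) (?A p) < e \<and> dist (?B x) (?B p) < e"
  proof (intro eventually_conj)
    show "\<forall>\<^sub>F x in nhds p. x \<in> S" using S eventually_nhds by blast
    have "isCont ?A p" "isCont ?B p"
      using cont S continuous_on_eq_continuous_at by blast+
    then show "\<forall>\<^sub>F x in nhds p. dist (?A x) (?A p) < e" "\<forall>\<^sub>F x in nhds p. dist (?B x) (?B p) < e"
      using \<open>e > 0\<close> unfolding isCont_def tendsto_at_iff_tendsto_nhds by (blast intro: tendstoD)+
  qed
  then obtain d where "d > 0" and d: "\<And>x. dist x p < d \<Longrightarrow> x \<in> S \<and> dist (?A x) (?A p) < e \<and> dist (?B x) (?B p) < e"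
    unfolding eventually_nhds_metric by blast
  define h where "h = d / (norm a + norm b + 1)"
  have pos: "norm a + norm b + 1 > 0" by (simp add: add_nonneg_pos)
  then have "h > 0" using \<open>d > 0\<close> by (simp add: h_def)
  have near: "dist (p + s *\<^sub>R a + t *\<^sub>R b) p < d" if "0 \<le> s" "s \<le> h" "0 \<le> t" "t \<le> h" for s t
  proof -
    have "dist (p + s *\<^sub>R a + t *\<^sub>R b) p = norm (s *\<^sub>R a + t *\<^sub>R b)" by (simp add: dist_norm)
    also have "\<dots> \<le> s * norm a + t * norm b"
      using norm_triangle_ineq[of "s *\<^sub>R a" "t *\<^sub>R b"] that by simp
    also have "\<dots> \<le> h * norm a + h * norm b" using that by (intro add_mono mult_right_mono) auto
    also have "\<dots> < h * (norm a + norm b + 1)" using \<open>h > 0\<close> by (simp add: algebra_simps)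
    also have "\<dots> = d" using pos by (simp add: h_def)
    finally show ?thesis .
  qed
  have near': "dist (p + s *\<^sub>R b + t *\<^sub>R a) p < d" if "0 \<le> s" "s \<le> h" "0 \<le> t" "t \<le> h" for s t
    using near[OF that(3,4,1,2)] by (simp add: add_ac)
  obtain s t where st: "s \<in> {0..h}" "t \<in> {0..h}" and
    1: "f (p + h *\<^sub>R a + h *\<^sub>R b) - f (p + h *\<^sub>R a) - f (p + h *\<^sub>R b) + f p = h\<^sup>2 * ?A (p + s *\<^sub>R a + t *\<^sub>R b)"
    using second_difference_MVT[OF S(1) f(1,2) \<open>h > 0\<close>] near d by blast
  obtain s' t' where st': "s' \<in> {0..h}" "t' \<in> {0..h}" and
    2: "f (p + h *\<^sub>R b + h *\<^sub>R a) - f (p + h *\<^sub>R b) - f (p + h *\<^sub>R a) + f p = h\<^sup>2 * ?B (p + s' *\<^sub>R b + t' *\<^sub>R a)"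
    using second_difference_MVT[OF S(1) f(1,3) \<open>h > 0\<close>] near' d by blast
  have "p + h *\<^sub>R b + h *\<^sub>R a = p + h *\<^sub>R a + h *\<^sub>R b" by (simp add: add_ac)
  with 2 have "f (p + h *\<^sub>R a + h *\<^sub>R b) - f (p + h *\<^sub>R b) - f (p + h *\<^sub>R a) + f p
      = h\<^sup>2 * ?B (p + s' *\<^sub>R b + t' *\<^sub>R a)" by simp
  with 1 have "h\<^sup>2 * ?A (p + s *\<^sub>R a + t *\<^sub>R b) = h\<^sup>2 * ?B (p + s' *\<^sub>R b + t' *\<^sub>R a)" by linarith
  then have "?A (p + s *\<^sub>R a + t *\<^sub>R b) = ?B (p + s' *\<^sub>R b + t' *\<^sub>R a)" using \<open>h > 0\<close> by simp
  moreover have "dist (?A (p + s *\<^sub>R a + t *\<^sub>R b)) (?A p) < e" "dist (?B (p + s' *\<^sub>R b + t' *\<^sub>R a)) (?B p) < e"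
    using near near' d st st' by auto
  ultimately show False unfolding e_def dist_real_def by argo
qed

section \<open>Completeness of the smooth functions\<close>

lemma partials_diff:
  assumes "open S" "smooth_bounded S f" "smooth_bounded S g" "es \<in> lists Basis" "p \<in> S"
  shows "partials es (\<lambda>p. f p - g p) p = partials es f p - partials es g p"
  using assms(4,5)
proof (induction es arbitrary: p rule: list.induct)
  case (Cons e es)
  have d: "partials es f differentiable_on S" "partials es g differentiable_on S"
    using assms(2,3) Cons unfolding smooth_bounded_def by auto
  have "pdiff e (partials es (\<lambda>p. f p - g p)) p = pdiff e (\<lambda>p. partials es f p - partials es g p) p"
    by (rule pdiff_cong[OF assms(1) Cons.prems(2)]) (use Cons in auto)
  also have "\<dots> = pdiff e (partials es f) p - pdiff e (partials es g) p"
    using pdiff_add[OF assms(1) differentiable_on_diff[OF d] d(2) Cons.prems(2), of e] by simp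
  finally show ?case by simp
qed simp

lemma Ck_norm_triangle_diff:
  assumes "open S" "S \<noteq> {}" "smooth_bounded S f" "smooth_bounded S g"
  shows "Ck_norm S k (\<lambda>p. f p - g p) \<le> Ck_norm S k f + Ck_norm S k g"
proof (rule Ck_norm_leI[OF assms(2)])
  fix es :: "'a list" and p assume *: "es \<in> lists Basis" "length es \<le> k" "p \<in> S"
  have "norm (partials es (\<lambda>p. f p - g p) p) \<le> norm (partials es f p) + norm (partials es g p)"
    using partials_diff[OF assms(1,3,4) *(1,3)] norm_triangle_ineq4 by metis
  also have "\<dots> \<le> Ck_norm S k f + Ck_norm S k g"
    by (intro add_mono norm_partials_le_Ck_norm assms *)
  finally show "norm (partials es (\<lambda>p. f p - g p) p) \<le> Ck_norm S k f + Ck_norm S k g" .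
qed

text \<open>Near each point this is the theorem on limits of sequences of derivatives on a convex set, namely on a
ball.  Uniform convergence of the partial derivatives gives convergence of the differentials in
operator norm, since a differential is the sum of \<open>DIM('a)\<close> partial derivatives.\<close>

lemma uniform_limit_of_partials:
  fixes f :: "nat \<Rightarrow> 'a::euclidean_space \<Rightarrow> 'b::banach"
  assumes S: "open S" and f: "\<And>n. f n differentiable_on S"
    and lim: "\<And>x. x \<in> S \<Longrightarrow> (\<lambda>n. f n x) \<longlonglongrightarrow> g x"
    and unif: "\<And>e. e \<in> Basis \<Longrightarrow> uniform_limit S (\<lambda>n. pdiff e (f n)) (g' e) sequentially"
  shows "g differentiable_on S" "\<And>e x. e \<in> Basis \<Longrightarrow> x \<in> S \<Longrightarrow> pdiff e g x = g' e x"
proof -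
  let ?L = "\<lambda>x h. \<Sum>e\<in>Basis. (h \<bullet> e) *\<^sub>R g' e x"
  have D: "(g has_derivative ?L x) (at x)" if x: "x \<in> S" for x
  proof -
    obtain r where r: "r > 0" "ball x r \<subseteq> S" using S x openE by blast
    have "\<exists>G. \<forall>y\<in>ball x r. (\<lambda>n. f n y) \<longlonglongrightarrow> G y \<and> (G has_derivative ?L y) (at y within ball x r)"
    proof (rule has_derivative_sequence)
      show "convex (ball x r)" by simp
      show "x \<in> ball x r" using r by simp
      show "(\<lambda>n. f n x) \<longlonglongrightarrow> g x" using lim x .
      show "(f n has_derivative (\<lambda>h. \<Sum>e\<in>Basis. (h \<bullet> e) *\<^sub>R pdiff e (f n) y)) (at y within ball x r)"
        if "y \<in> ball x r" for n y
        using has_derivative_partials[OF f S] that r has_derivative_at_withinI by blast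
      fix c :: real assume "c > 0"
      define c' where "c' = c / DIM('a)"
      have "c' > 0" using \<open>c > 0\<close> by (simp add: c'_def)
      then have "\<forall>\<^sub>F n in sequentially. \<forall>e\<in>Basis. \<forall>y\<in>S. dist (pdiff e (f n) y) (g' e y) < c'"
        using unif by (intro eventually_ball_finite) (auto simp: uniform_limit_iff)
      then show "\<forall>\<^sub>F n in sequentially. \<forall>y\<in>ball x r. \<forall>h.
          norm ((\<Sum>e\<in>Basis. (h \<bullet> e) *\<^sub>R pdiff e (f n) y) - ?L y h) \<le> c * norm h"
      proof eventually_elim
        case (elim n)
        show ?case
        proof (intro ballI allI)
          fix y h assume "y \<in> ball x r"
          then have "y \<in> S" using r by auto
          have "norm ((\<Sum>e\<in>Basis. (h \<bullet> e) *\<^sub>R pdiff e (f n) y) - ?L y h)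
              = norm (\<Sum>e\<in>Basis. (h \<bullet> e) *\<^sub>R (pdiff e (f n) y - g' e y))"
            by (simp add: sum_subtractf scaleR_diff_right)
          also have "\<dots> \<le> (\<Sum>e\<in>(Basis :: 'a set). norm h * c')"
          proof (rule sum_norm_le)
            fix e :: 'a assume e: "e \<in> Basis"
            have "norm ((h \<bullet> e) *\<^sub>R (pdiff e (f n) y - g' e y)) = \<bar>h \<bullet> e\<bar> * dist (pdiff e (f n) y) (g' e y)"
              by (simp add: dist_norm)
            also have "\<dots> \<le> norm h * c'"
              using elim e \<open>y \<in> S\<close> Basis_le_norm[OF e, of h] by (intro mult_mono) (auto intro: less_imp_le)
            finally show "norm ((h \<bullet> e) *\<^sub>R (pdiff e (f n) y - g' e y)) \<le> norm h * c'" .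
          qed
          also have "\<dots> = c * norm h" by (simp add: c'_def)
          finally show "norm ((\<Sum>e\<in>Basis. (h \<bullet> e) *\<^sub>R pdiff e (f n) y) - ?L y h) \<le> c * norm h" .
        qed
      qed
    qed
    then obtain G where G: "\<forall>y\<in>ball x r. (\<lambda>n. f n y) \<longlonglongrightarrow> G y
        \<and> (G has_derivative ?L y) (at y within ball x r)" by (elim exE)
    have "G y = g y" if "y \<in> ball x r" for y
      using LIMSEQ_unique[OF _ lim, of y "G y"] G that r by blast
    moreover have "(G has_derivative ?L x) (at x)"
      using bspec[OF G, of x] r at_within_open[of x "ball x r"] by simp
    ultimately show ?thesis
      using has_derivative_transform_within_open[of G _ x UNIV "ball x r" g] r by auto
  qed
  show "g differentiable_on S"
    using D unfolding differentiable_on_def differentiable_def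
    by (meson has_derivative_at_withinI)
  fix e x assume "e \<in> (Basis :: 'a set)" "x \<in> S"
  then have "pdiff e g x = (\<Sum>e'\<in>Basis. (e \<bullet> e') *\<^sub>R g' e' x)"
    using pdiff_eqI[OF D] by blast
  also have "\<dots> = (\<Sum>e'\<in>Basis. if e' = e then g' e' x else 0)"
    using \<open>e \<in> Basis\<close> by (intro sum.cong) (auto simp: inner_Basis)
  finally show "pdiff e g x = g' e x" using \<open>e \<in> Basis\<close> by simp
qed

text \<open>By completeness of the target space the derivatives
converge along a null sequence; letting \<open>\<epsilon>2\<close> run through this sequence in the Cauchy estimate bounds the
remainder for every small \<open>\<epsilon>1\<close>, and \<open>uniform_limit_of_partials\<close> identifies the limits of the
derivatives as the derivatives of the limit.\<close>

lemma expands_of_Cauchy: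
  fixes F :: "real \<Rightarrow> 'a::euclidean_space \<Rightarrow> 'b::banach"
  assumes S: "open S" "S \<noteq> {}"
    and F: "\<forall>\<^sub>F \<epsilon> in at_right 0. smooth_bounded S (F \<epsilon>)"
    and Cauchy: "\<And>k. \<exists>K. \<exists>\<delta>>0. \<forall>\<epsilon>1\<in>{0<..<\<delta>}. \<forall>\<epsilon>2\<in>{0<..<\<delta>}.
                  Ck_norm S k (\<lambda>p. F \<epsilon>1 p - F \<epsilon>2 p) \<le> K * (\<epsilon>1 + \<epsilon>2)"
  shows "\<exists>F0. expands S F F0"
proof -
  obtain \<delta>0 where \<delta>0: "\<delta>0 > 0" "\<And>\<epsilon>. 0 < \<epsilon> \<Longrightarrow> \<epsilon> < \<delta>0 \<Longrightarrow> smooth_bounded S (F \<epsilon>)"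
    using F unfolding eventually_at_right_field by auto
  have "\<exists>K. \<exists>\<delta>>0. \<delta> \<le> \<delta>0 \<and> (\<forall>\<epsilon>1\<in>{0<..<\<delta>}. \<forall>\<epsilon>2\<in>{0<..<\<delta>}. \<forall>p\<in>S.
      norm (partials es (F \<epsilon>1) p - partials es (F \<epsilon>2) p) \<le> K * (\<epsilon>1 + \<epsilon>2))" if es: "es \<in> lists Basis" for es
  proof -
    obtain K \<delta> where "\<delta> > 0" and K: "\<And>\<epsilon>1 \<epsilon>2. \<epsilon>1 \<in> {0<..<\<delta>} \<Longrightarrow> \<epsilon>2 \<in> {0<..<\<delta>} \<Longrightarrow>
        Ck_norm S (length es) (\<lambda>p. F \<epsilon>1 p - F \<epsilon>2 p) \<le> K * (\<epsilon>1 + \<epsilon>2)"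
      using Cauchy[of "length es"] by blast
    have "norm (partials es (F \<epsilon>1) p - partials es (F \<epsilon>2) p) \<le> K * (\<epsilon>1 + \<epsilon>2)"
      if "\<epsilon>1 \<in> {0<..<min \<delta> \<delta>0}" "\<epsilon>2 \<in> {0<..<min \<delta> \<delta>0}" "p \<in> S" for \<epsilon>1 \<epsilon>2 p
    proof -
      have sm: "smooth_bounded S (F \<epsilon>1)" "smooth_bounded S (F \<epsilon>2)" using \<delta>0 that by auto
      have "norm (partials es (\<lambda>p. F \<epsilon>1 p - F \<epsilon>2 p) p) \<le> K * (\<epsilon>1 + \<epsilon>2)"
        by (rule order_trans[OF norm_partials_le_Ck_norm K])
          (use sm es that in \<open>auto intro: smooth_bounded_diff[OF S(1)]\<close>)
      then show ?thesis by (simp add: partials_diff[OF S(1) sm es that(3)])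
    qed
    then show ?thesis using \<open>\<delta> > 0\<close> \<delta>0
      by (intro exI[of _ K] exI[of _ "min \<delta> \<delta>0"]) auto
  qed
  then obtain K \<delta> where \<delta>: "\<And>es. es \<in> lists Basis \<Longrightarrow> \<delta> es > 0" "\<And>es. es \<in> lists Basis \<Longrightarrow> \<delta> es \<le> \<delta>0"
    and K: "\<And>es \<epsilon>1 \<epsilon>2 p. es \<in> lists Basis \<Longrightarrow> 0 < \<epsilon>1 \<Longrightarrow> \<epsilon>1 < \<delta> es \<Longrightarrow> 0 < \<epsilon>2 \<Longrightarrow> \<epsilon>2 < \<delta> es \<Longrightarrow> p \<in> S \<Longrightarrow>
      norm (partials es (F \<epsilon>1) p - partials es (F \<epsilon>2) p) \<le> K es * (\<epsilon>1 + \<epsilon>2)"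
    unfolding greaterThanLessThan_iff Ball_def by metis
  \<comment> \<open>A null sequence inside the range where all \<open>F \<epsilon>\<close> are smooth\<close>
  define e where "e n = \<delta>0 / real (n + 2)" for n :: nat
  have e: "0 < e n" "e n < \<delta>0" for n using \<delta>0(1) by (auto simp: e_def field_simps add_pos_nonneg)
  have e0: "e \<longlonglongrightarrow> 0"
    unfolding e_def by (rule LIMSEQ_ignore_initial_segment[OF lim_const_over_n])
  have e_small: "\<forall>\<^sub>F n in sequentially. e n < \<delta> es" if "es \<in> lists Basis" for es
    using order_tendstoD(2)[OF e0 \<delta>(1)[OF that]] .
  have lim: "\<exists>l. (\<lambda>n. partials es (F (e n)) p) \<longlonglongrightarrow> l" if es: "es \<in> lists Basis" and p: "p \<in> S" for es p
  proof -
    have "Cauchy (\<lambda>n. partials es (F (e n)) p)"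
    proof (rule metric_CauchyI)
      fix c :: real assume "c > 0"
      have "(\<lambda>n. \<bar>K es\<bar> * e n) \<longlonglongrightarrow> \<bar>K es\<bar> * 0" by (intro tendsto_intros e0)
      then have "\<forall>\<^sub>F n in sequentially. \<bar>K es\<bar> * e n < c / 2"
        using \<open>c > 0\<close> by (intro order_tendstoD(2)) auto
      with e_small[OF es] obtain N where N: "\<And>n. n \<ge> N \<Longrightarrow> e n < \<delta> es" "\<And>n. n \<ge> N \<Longrightarrow> \<bar>K es\<bar> * e n < c / 2"
        using eventually_conj unfolding eventually_sequentially by (metis le_trans nle_le)
      have "dist (partials es (F (e m)) p) (partials es (F (e n)) p) < c" if "m \<ge> N" "n \<ge> N" for m n
      proof -
        have "dist (partials es (F (e m)) p) (partials es (F (e n)) p) \<le> K es * (e m + e n)"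
          using K es e N that p by (simp add: dist_norm)
        also have "\<dots> \<le> \<bar>K es\<bar> * (e m + e n)" using e by (intro mult_right_mono) (auto simp: less_imp_le)
        also have "\<dots> < c" using N(2)[OF that(1)] N(2)[OF that(2)] by (simp add: distrib_left)
        finally show ?thesis .
      qed
      then show "\<exists>N. \<forall>m\<ge>N. \<forall>n\<ge>N. dist (partials es (F (e m)) p) (partials es (F (e n)) p) < c" by blast
    qed
    then show ?thesis by (simp add: Cauchy_convergent_iff convergent_def)
  qed
  define G where "G es p = lim (\<lambda>n. partials es (F (e n)) p)" for es p
  have G: "(\<lambda>n. partials es (F (e n)) p) \<longlonglongrightarrow> G es p" if "es \<in> lists Basis" "p \<in> S" for es p
    unfolding G_def using lim[OF that] convergent_LIMSEQ_iff convergent_def by blast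
  have FG: "norm (partials es (F \<epsilon>) p - G es p) \<le> K es * \<epsilon>"
    if "es \<in> lists Basis" "0 < \<epsilon>" "\<epsilon> < \<delta> es" "p \<in> S" for es \<epsilon> p
  proof -
    have "(\<lambda>n. norm (partials es (F \<epsilon>) p - partials es (F (e n)) p)) \<longlonglongrightarrow> norm (partials es (F \<epsilon>) p - G es p)"
      by (intro tendsto_intros G that)
    moreover have "(\<lambda>n. K es * (\<epsilon> + e n)) \<longlonglongrightarrow> K es * (\<epsilon> + 0)" by (intro tendsto_intros e0)
    moreover have "\<forall>\<^sub>F n in sequentially. norm (partials es (F \<epsilon>) p - partials es (F (e n)) p) \<le> K es * (\<epsilon> + e n)"
      using e_small[OF that(1)] by eventually_elim (use K that e in blast)
    ultimately have "norm (partials es (F \<epsilon>) p - G es p) \<le> K es * (\<epsilon> + 0)"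
      by (intro tendsto_le[OF sequentially_bot]) auto
    then show ?thesis by simp
  qed
  have unif: "uniform_limit S (\<lambda>n. partials es (F (e n))) (G es) sequentially" if es: "es \<in> lists Basis" for es
  proof (rule uniform_limitI)
    fix c :: real assume "c > 0"
    have "(\<lambda>n. K es * e n) \<longlonglongrightarrow> K es * 0" by (intro tendsto_intros e0)
    then have "\<forall>\<^sub>F n in sequentially. K es * e n < c" using \<open>c > 0\<close> by (intro order_tendstoD(2)) auto
    with e_small[OF es] show "\<forall>\<^sub>F n in sequentially. \<forall>x\<in>S. dist (partials es (F (e n)) x) (G es x) < c"
    proof eventually_elim
      case (elim n)
      show ?case
      proof
        fix x assume "x \<in> S"
        from FG[OF es e(1) elim(1) this] elim(2)
        show "dist (partials es (F (e n)) x) (G es x) < c" by (simp add: dist_norm)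
      qed
    qed
  qed
  have dG: "G es differentiable_on S" "\<And>e p. e \<in> Basis \<Longrightarrow> p \<in> S \<Longrightarrow> pdiff e (G es) p = G (e # es) p"
    if es: "es \<in> lists Basis" for es
  proof -
    have d: "partials es (F (e n)) differentiable_on S" for n
      using \<delta>0(2)[OF e] es unfolding smooth_bounded_def by blast
    have u: "uniform_limit S (\<lambda>n. pdiff e' (partials es (F (e n)))) (G (e' # es)) sequentially" if "e' \<in> Basis" for e'
      using unif[of "e' # es"] es that by simp
    note * = uniform_limit_of_partials[OF S(1), of "\<lambda>n. partials es (F (e n))" "G es" "\<lambda>e'. G (e' # es)", OF d G[OF es] u]
    show "G es differentiable_on S" using *(1) by blast
    show "pdiff e' (G es) p = G (e' # es) p" if "e' \<in> Basis" "p \<in> S" for e' p using *(2) that by blast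
  qed
  have G_partials: "partials es (G []) p = G es p" if "es \<in> lists Basis" "p \<in> S" for es p
    using that
  proof (induction es arbitrary: p rule: list.induct)
    case (Cons e' es)
    have "pdiff e' (partials es (G [])) p = pdiff e' (G es) p"
      by (rule pdiff_cong[OF S(1) Cons.prems(2)]) (use Cons in auto)
    then show ?case using dG(2)[of es e' p] Cons.prems by simp
  qed simp
  have sm: "smooth_bounded S (G [])"
    unfolding smooth_bounded_def
  proof (intro ballI conjI)
    fix es :: "'a list" assume es: "es \<in> lists Basis"
    show "partials es (G []) differentiable_on S"
      by (rule differentiable_on_cong[OF dG(1)[OF es]]) (use G_partials es in auto)
    define \<epsilon> where "\<epsilon> = \<delta> es / 2"
    have \<epsilon>: "0 < \<epsilon>" "\<epsilon> < \<delta> es" "\<epsilon> < \<delta>0" using \<delta>[OF es] by (auto simp: \<epsilon>_def)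
    have "bounded (partials es (F \<epsilon>) ` S)"
      using \<delta>0(2)[OF \<epsilon>(1,3)] es unfolding smooth_bounded_def by blast
    then obtain M where M: "\<And>p. p \<in> S \<Longrightarrow> norm (partials es (F \<epsilon>) p) \<le> M"
      by (auto simp: bounded_iff)
    have "norm (partials es (G []) p) \<le> M + K es * \<epsilon>" if "p \<in> S" for p
    proof -
      have "norm (G es p) \<le> norm (partials es (F \<epsilon>) p) + norm (partials es (F \<epsilon>) p - G es p)"
        by (metis norm_minus_commute norm_triangle_sub add.commute)
      with M[OF that] FG[OF es \<epsilon>(1,2) that] G_partials[OF es that] show ?thesis by simp
    qed
    then show "bounded (partials es (G []) ` S)" by (auto simp: bounded_iff)
  qed
  have "Ck_bigo S (\<lambda>\<epsilon>. \<epsilon>) k (\<lambda>\<epsilon> p. F \<epsilon> p - G [] p)" for k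
    unfolding Ck_bigo_iff_partials
  proof (intro ballI impI exI)
    fix es :: "'a list" assume es: "es \<in> lists Basis"
    have "\<forall>\<^sub>F \<epsilon> in at_right 0. 0 < \<epsilon> \<and> \<epsilon> < \<delta> es"
      using eventually_at_right_real[OF \<delta>(1)[OF es]] by simp
    with F show "\<forall>\<^sub>F \<epsilon> in at_right 0. partials es (\<lambda>p. F \<epsilon> p - G [] p) differentiable_on S \<and>
        (\<forall>p\<in>S. norm (partials es (\<lambda>p. F \<epsilon> p - G [] p) p) \<le> K es * \<bar>\<epsilon>\<bar>)"
    proof eventually_elim
      case (elim \<epsilon>)
      have "smooth_bounded S (\<lambda>p. F \<epsilon> p - G [] p)"
        using smooth_bounded_diff[OF S(1) elim(1) sm] .
      then have "partials es (\<lambda>p. F \<epsilon> p - G [] p) differentiable_on S"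
        using es unfolding smooth_bounded_def by blast
      moreover have "norm (partials es (\<lambda>p. F \<epsilon> p - G [] p) p) \<le> K es * \<bar>\<epsilon>\<bar>" if "p \<in> S" for p
        using FG[OF es _ _ that, of \<epsilon>] elim(2)
        by (simp add: partials_diff[OF S(1) elim(1) sm es that] G_partials[OF es that])
      ultimately show ?case by blast
    qed
  qed
  moreover have "\<forall>\<^sub>F \<epsilon> in at_right 0. smooth_bounded S (\<lambda>p. F \<epsilon> p - G [] p)"
    using F by eventually_elim (rule smooth_bounded_diff[OF S(1) _ sm])
  ultimately have "expands S F (G [])"
    using sm unfolding expands_iff_bigo_family[OF S] bigo_family_def by blast
  then show ?thesis by (rule exI[of "\<lambda>F0. expands S F F0"])
qed

section \<open>The elliptic equation as its zeroth-order coefficient tends to one\<close>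

lemma plane_Basis: "(1, 0) \<in> (Basis :: (real \<times> real) set)" "(0, 1) \<in> (Basis :: (real \<times> real) set)"
  by (auto simp: Basis_prod_def)

lemma smooth_bounded_laplacian:
  assumes "open \<Omega>" "smooth_bounded \<Omega> f"
  shows "smooth_bounded \<Omega> (laplacian f)"
proof -
  have "smooth_bounded \<Omega> (\<lambda>p. dx (dx f) p + dy (dy f) p)"
    by (intro smooth_bounded_add[OF assms(1)] smooth_bounded_pdiff plane_Basis assms(2))
  then show ?thesis by (simp add: laplacian_def[abs_def])
qed

lemma expands_laplacian:
  assumes "open \<Omega>" "\<Omega> \<noteq> {}" "expands \<Omega> F F0"
  shows "expands \<Omega> (\<lambda>\<epsilon>. laplacian (F \<epsilon>)) (laplacian F0)"
proof -
  have "expands \<Omega> (\<lambda>\<epsilon> p. dx (dx (F \<epsilon>)) p + dy (dy (F \<epsilon>)) p) (\<lambda>p. dx (dx F0) p + dy (dy F0) p)"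
    by (intro expands_add expands_pdiff plane_Basis assms)
  then show ?thesis by (simp add: laplacian_def[abs_def])
qed

text \<open>No limit function in the class \<open>B\<close> is at hand, so the solutions are compared with each other.  Comparison
with one fixed solution bounds the family in every \<open>C\<^sup>k\<close> norm.  This makes \<open>(\<mu> - 1) w\<close> an \<open>O(\<epsilon>)\<close> term that
can be moved to the right-hand side: all \<open>w\<close> then solve equations with the same operator, whose
right-hand sides differ by \<open>O(\<epsilon>1 + \<epsilon>2)\<close>, and stability makes the family Cauchy.\<close>

lemma elliptic_limit:
  fixes w f :: "real \<Rightarrow> field" and \<mu> :: "real \<Rightarrow> real"
  assumes \<Omega>: "open \<Omega>" "\<Omega> \<noteq> {}"
    and stable: "elliptic_stable \<Omega> \<nu> B"
    and w: "\<forall>\<^sub>F \<epsilon> in at_right 0. w \<epsilon> \<in> B \<and> smooth_bounded \<Omega> (w \<epsilon>) \<and>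
              (\<forall>p\<in>\<Omega>. \<mu> \<epsilon> * w \<epsilon> p - \<nu> * laplacian (w \<epsilon>) p = f \<epsilon> p)"
    and \<mu>: "\<forall>\<^sub>F \<epsilon> in at_right 0. 1 \<le> \<mu> \<epsilon>" "(\<lambda>\<epsilon>. \<mu> \<epsilon> - 1) \<in> O[at_right 0](\<lambda>\<epsilon>. \<epsilon>)"
    and f: "expands \<Omega> f f0"
  shows "\<exists>w0. expands \<Omega> w w0 \<and> (\<forall>p\<in>\<Omega>. w0 p - \<nu> * laplacian w0 p = f0 p)"
proof -
  have "\<forall>\<^sub>F \<epsilon> in at_right 0. \<mu> \<epsilon> \<le> 2"
  proof -
    obtain K where K: "K > 0" "\<forall>\<^sub>F \<epsilon> in at_right 0. norm (\<mu> \<epsilon> - 1) \<le> K * norm \<epsilon>"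
      using \<mu>(2) by (auto elim: landau_o.bigE)
    have "\<forall>\<^sub>F \<epsilon> in at_right 0. 0 < \<epsilon> \<and> \<epsilon> < 1 / K"
      using eventually_at_right_real[of 0 "1 / K"] K by simp
    with K(2) show ?thesis
      by eventually_elim (use K(1) in \<open>auto simp: field_simps abs_le_iff\<close>)
  qed
  with w \<mu>(1) have "\<forall>\<^sub>F \<epsilon> in at_right 0. \<mu> \<epsilon> \<in> {1..2} \<and> w \<epsilon> \<in> B \<and> smooth_bounded \<Omega> (w \<epsilon>) \<and>
      (\<forall>p\<in>\<Omega>. \<mu> \<epsilon> * w \<epsilon> p - \<nu> * laplacian (w \<epsilon>) p = f \<epsilon> p)"
    by eventually_elim simp
  then obtain \<delta> where "\<delta> > 0" and good: "\<And>\<epsilon>. 0 < \<epsilon> \<Longrightarrow> \<epsilon> < \<delta> \<Longrightarrow> \<mu> \<epsilon> \<in> {1..2}"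
    "\<And>\<epsilon>. 0 < \<epsilon> \<Longrightarrow> \<epsilon> < \<delta> \<Longrightarrow> w \<epsilon> \<in> B" "\<And>\<epsilon>. 0 < \<epsilon> \<Longrightarrow> \<epsilon> < \<delta> \<Longrightarrow> smooth_bounded \<Omega> (w \<epsilon>)"
    "\<And>\<epsilon> p. 0 < \<epsilon> \<Longrightarrow> \<epsilon> < \<delta> \<Longrightarrow> p \<in> \<Omega> \<Longrightarrow> \<mu> \<epsilon> * w \<epsilon> p - \<nu> * laplacian (w \<epsilon>) p = f \<epsilon> p"
    unfolding eventually_at_right_field by auto
  have ev_range: "\<forall>\<^sub>F \<epsilon> in at_right 0. 0 < \<epsilon> \<and> \<epsilon> < \<delta>"
    using eventually_at_right_real[OF \<open>\<delta> > 0\<close>] by simp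
  have w_smooth: "\<forall>\<^sub>F \<epsilon> in at_right 0. smooth_bounded \<Omega> (w \<epsilon>)"
    using w by (rule eventually_mono) blast

  \<comment> \<open>\<open>H \<epsilon>\<close> is the difference of the right-hand sides when \<open>w1\<close> is inserted into the equation with
    coefficient \<open>\<mu> \<epsilon>\<close>; any smooth member of \<open>B\<close> could serve as \<open>w1\<close>.\<close>
  define w1 where "w1 = w (\<delta> / 2)"
  have w1: "w1 \<in> B" "smooth_bounded \<Omega> w1" using good \<open>\<delta> > 0\<close> by (auto simp: w1_def)
  define H where "H \<epsilon> p = f \<epsilon> p - (\<mu> \<epsilon> *\<^sub>R w1 p - \<nu> *\<^sub>R laplacian w1 p)" for \<epsilon> p
  have \<mu>1: "\<mu> \<in> O[at_right 0](\<lambda>_. 1)"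
  proof (rule bigoI[of _ 2])
    show "\<forall>\<^sub>F \<epsilon> in at_right 0. norm (\<mu> \<epsilon>) \<le> 2 * norm (1 :: real)"
      using ev_range by eventually_elim (use good(1) in force)
  qed
  have \<mu>w1: "bigo_family \<Omega> (\<lambda>_. 1) (\<lambda>\<epsilon> p. \<mu> \<epsilon> *\<^sub>R w1 p)"
    using bigo_family_bilinear[OF \<Omega>(1) bounded_bilinear_scaleR bigo_family_const[OF \<mu>1, of \<Omega> "1 :: real"]
        bigo_family_fixed[OF w1(2)]] by simp
  have H: "bigo_family \<Omega> (\<lambda>_. 1) H"
    unfolding H_def[abs_def]
    by (intro bigo_family_diff[OF \<Omega>(1)] expands_bigo_1[OF \<Omega> f] \<mu>w1 bigo_family_fixed
        smooth_bounded_bounded_linear[OF \<Omega>(1) bounded_linear_scaleR_right]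
        smooth_bounded_laplacian[OF \<Omega>(1) w1(2)])
  have w_w1: "Ck_bigo \<Omega> (\<lambda>_. 1) k (\<lambda>\<epsilon> p. w \<epsilon> p - w1 p)" for k
  proof -
    obtain m C where C: "\<forall>\<mu>\<in>{1..2}. \<forall>u1\<in>B. \<forall>u2\<in>B. smooth_bounded \<Omega> u1 \<longrightarrow> smooth_bounded \<Omega> u2 \<longrightarrow>
        Ck_norm \<Omega> k (\<lambda>p. u1 p - u2 p)
        \<le> C * Ck_norm \<Omega> m (\<lambda>p. (\<mu> * u1 p - \<nu> * laplacian u1 p) - (\<mu> * u2 p - \<nu> * laplacian u2 p))"
      using stable[unfolded elliptic_stable_def, THEN spec, of k] by (elim exE)
    have "(\<lambda>\<epsilon>. Ck_norm \<Omega> m (H \<epsilon>)) \<in> O[at_right 0](\<lambda>_. 1)"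
      using H Ck_bigo_iff_Ck_norm[OF \<Omega>(2)] unfolding bigo_family_def by blast
    moreover have "(\<lambda>\<epsilon>. Ck_norm \<Omega> k (\<lambda>p. w \<epsilon> p - w1 p)) \<in> O[at_right 0](\<lambda>\<epsilon>. Ck_norm \<Omega> m (H \<epsilon>))"
    proof (rule bigoI[of _ "\<bar>C\<bar>"])
      show "\<forall>\<^sub>F \<epsilon> in at_right 0. norm (Ck_norm \<Omega> k (\<lambda>p. w \<epsilon> p - w1 p)) \<le> \<bar>C\<bar> * norm (Ck_norm \<Omega> m (H \<epsilon>))"
        using ev_range
      proof eventually_elim
        case (elim \<epsilon>)
        have "Ck_norm \<Omega> k (\<lambda>p. w \<epsilon> p - w1 p)
            \<le> C * Ck_norm \<Omega> m (\<lambda>p. (\<mu> \<epsilon> * w \<epsilon> p - \<nu> * laplacian (w \<epsilon>) p) - (\<mu> \<epsilon> * w1 p - \<nu> * laplacian w1 p))"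
          by (rule C[rule_format]) (use good elim w1 in auto)
        also have "\<dots> = C * Ck_norm \<Omega> m (H \<epsilon>)"
          by (intro arg_cong[where f = "\<lambda>x. C * x"] Ck_norm_cong[OF \<Omega>(1)]) (use good(4) elim in \<open>auto simp: H_def\<close>)
        also have "\<dots> \<le> \<bar>C\<bar> * norm (Ck_norm \<Omega> m (H \<epsilon>))"
          by (metis abs_ge_self abs_mult real_norm_def)
        finally show ?case
          using Ck_norm_nonneg[OF smooth_bounded_diff[OF \<Omega>(1) good(3) w1(2)] \<Omega>(2)] elim by simp
      qed
    qed
    ultimately have "(\<lambda>\<epsilon>. Ck_norm \<Omega> k (\<lambda>p. w \<epsilon> p - w1 p)) \<in> O[at_right 0](\<lambda>_. 1)"
      by (rule landau_o.big_trans[rotated])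
    moreover have "\<forall>\<^sub>F \<epsilon> in at_right 0. smooth_bounded \<Omega> (\<lambda>p. w \<epsilon> p - w1 p)"
      using w_smooth by eventually_elim (rule smooth_bounded_diff[OF \<Omega>(1) _ w1(2)])
    ultimately show ?thesis by (simp add: Ck_bigo_iff_Ck_norm[OF \<Omega>(2)])
  qed
  have "bigo_family \<Omega> (\<lambda>_. 1) (\<lambda>\<epsilon> p. w \<epsilon> p - w1 p)"
    unfolding bigo_family_def using w_w1 w_smooth
    by (auto elim!: eventually_mono intro: smooth_bounded_diff[OF \<Omega>(1) _ w1(2)])
  from bigo_family_add[OF \<Omega>(1) this bigo_family_fixed[OF w1(2)]]
  have w_bounded: "bigo_family \<Omega> (\<lambda>_. 1) w" by simp

  \<comment> \<open>\<open>g \<epsilon>\<close> is the right-hand side for the \<open>\<epsilon>\<close>-independent operator with \<open>\<mu> = 1\<close>.\<close>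
  define g where "g \<epsilon> p = f \<epsilon> p - (\<mu> \<epsilon> - 1) *\<^sub>R w \<epsilon> p" for \<epsilon> p
  have "expands \<Omega> g (\<lambda>p. f0 p - 0)"
    unfolding g_def[abs_def] by (intro expands_diff[OF \<Omega>] f expands_vanishing[OF \<Omega>] \<mu> w_bounded)
  then have g: "expands \<Omega> g f0" by simp
  have g_eq: "w \<epsilon> p - \<nu> * laplacian (w \<epsilon>) p = g \<epsilon> p" if "0 < \<epsilon>" "\<epsilon> < \<delta>" "p \<in> \<Omega>" for \<epsilon> p
    using good(4)[OF that] by (simp add: g_def algebra_simps)
  have "\<exists>w0. expands \<Omega> w w0"
  proof (rule expands_of_Cauchy[OF \<Omega> w_smooth])
    fix k
    obtain m C where C: "\<forall>\<mu>\<in>{1..2}. \<forall>u1\<in>B. \<forall>u2\<in>B. smooth_bounded \<Omega> u1 \<longrightarrow> smooth_bounded \<Omega> u2 \<longrightarrow>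
        Ck_norm \<Omega> k (\<lambda>p. u1 p - u2 p)
        \<le> C * Ck_norm \<Omega> m (\<lambda>p. (\<mu> * u1 p - \<nu> * laplacian u1 p) - (\<mu> * u2 p - \<nu> * laplacian u2 p))"
      using stable[unfolded elliptic_stable_def, THEN spec, of k] by (elim exE)
    have f0: "smooth_bounded \<Omega> f0" using g unfolding expands_def by auto
    have "(\<lambda>\<epsilon>. Ck_norm \<Omega> m (\<lambda>p. g \<epsilon> p - f0 p)) \<in> O[at_right 0](\<lambda>\<epsilon>. \<epsilon>)"
      using g unfolding expands_def by blast
    then obtain L where "\<forall>\<^sub>F \<epsilon> in at_right 0. norm (Ck_norm \<Omega> m (\<lambda>p. g \<epsilon> p - f0 p)) \<le> L * norm \<epsilon>"
      by (auto elim: landau_o.bigE)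
    moreover have "\<forall>\<^sub>F \<epsilon> in at_right 0. smooth_bounded \<Omega> (g \<epsilon>)"
      using g unfolding expands_def by auto
    ultimately have "\<forall>\<^sub>F \<epsilon> in at_right 0. smooth_bounded \<Omega> (\<lambda>p. g \<epsilon> p - f0 p)
        \<and> Ck_norm \<Omega> m (\<lambda>p. g \<epsilon> p - f0 p) \<le> L * \<bar>\<epsilon>\<bar>"
      by eventually_elim (simp add: smooth_bounded_diff[OF \<Omega>(1) _ f0])
    then obtain \<delta>1 where "\<delta>1 > 0" and L:
      "\<And>\<epsilon>. 0 < \<epsilon> \<Longrightarrow> \<epsilon> < \<delta>1 \<Longrightarrow> smooth_bounded \<Omega> (\<lambda>p. g \<epsilon> p - f0 p)"
      "\<And>\<epsilon>. 0 < \<epsilon> \<Longrightarrow> \<epsilon> < \<delta>1 \<Longrightarrow> Ck_norm \<Omega> m (\<lambda>p. g \<epsilon> p - f0 p) \<le> L * \<bar>\<epsilon>\<bar>"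
      unfolding eventually_at_right_field by auto
    have "Ck_norm \<Omega> k (\<lambda>p. w \<epsilon>1 p - w \<epsilon>2 p) \<le> (\<bar>C\<bar> * L) * (\<epsilon>1 + \<epsilon>2)"
      if "\<epsilon>1 \<in> {0<..<min \<delta> \<delta>1}" "\<epsilon>2 \<in> {0<..<min \<delta> \<delta>1}" for \<epsilon>1 \<epsilon>2
    proof -
      let ?d = "\<lambda>p. (g \<epsilon>1 p - f0 p) - (g \<epsilon>2 p - f0 p)"
      have "Ck_norm \<Omega> k (\<lambda>p. w \<epsilon>1 p - w \<epsilon>2 p)
          \<le> C * Ck_norm \<Omega> m (\<lambda>p. (1 * w \<epsilon>1 p - \<nu> * laplacian (w \<epsilon>1) p) - (1 * w \<epsilon>2 p - \<nu> * laplacian (w \<epsilon>2) p))"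
        by (rule C[rule_format]) (use good that in auto)
      also have "\<dots> = C * Ck_norm \<Omega> m ?d"
        by (intro arg_cong[where f = "\<lambda>x. C * x"] Ck_norm_cong[OF \<Omega>(1)]) (use g_eq that in auto)
      also have "\<dots> \<le> \<bar>C\<bar> * Ck_norm \<Omega> m ?d"
        using that by (intro mult_right_mono Ck_norm_nonneg smooth_bounded_diff[OF \<Omega>(1)] L \<Omega>) auto
      also have "Ck_norm \<Omega> m ?d \<le> Ck_norm \<Omega> m (\<lambda>p. g \<epsilon>1 p - f0 p) + Ck_norm \<Omega> m (\<lambda>p. g \<epsilon>2 p - f0 p)"
        using that by (intro Ck_norm_triangle_diff \<Omega> L) auto
      also have "\<dots> \<le> L * (\<epsilon>1 + \<epsilon>2)"
        using L(2)[of \<epsilon>1] L(2)[of \<epsilon>2] that by (simp add: distrib_left)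
      finally show ?thesis by (simp add: mult.assoc mult_left_mono)
    qed
    then show "\<exists>K. \<exists>\<delta>>0. \<forall>\<epsilon>1\<in>{0<..<\<delta>}. \<forall>\<epsilon>2\<in>{0<..<\<delta>}.
        Ck_norm \<Omega> k (\<lambda>p. w \<epsilon>1 p - w \<epsilon>2 p) \<le> K * (\<epsilon>1 + \<epsilon>2)"
      using \<open>\<delta> > 0\<close> \<open>\<delta>1 > 0\<close> by (intro exI[of _ "\<bar>C\<bar> * L"] exI[of _ "min \<delta> \<delta>1"]) auto
  qed
  then obtain w0 where w0: "expands \<Omega> w w0" ..
  have "expands \<Omega> (\<lambda>\<epsilon> p. w \<epsilon> p - \<nu> * laplacian (w \<epsilon>) p) (\<lambda>p. w0 p - \<nu> * laplacian w0 p)"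
    by (intro expands_diff[OF \<Omega>] expands_bounded_linear[OF \<Omega> bounded_linear_mult_right] expands_laplacian \<Omega> w0)
  then have "expands \<Omega> g (\<lambda>p. w0 p - \<nu> * laplacian w0 p)"
  proof (rule expands_cong[OF \<Omega>])
    show "\<forall>\<^sub>F \<epsilon> in at_right 0. \<forall>p\<in>\<Omega>. w \<epsilon> p - \<nu> * laplacian (w \<epsilon>) p = g \<epsilon> p"
      using ev_range by eventually_elim (use g_eq in blast)
  qed simp
  then show ?thesis using w0 expands_unique[OF \<Omega> _ g] by blast
qed

section \<open>Scalar coefficients\<close>

abbreviation near :: "(real \<Rightarrow> real) \<Rightarrow> real \<Rightarrow> bool" where
  "near c c0 \<equiv> (\<lambda>\<epsilon>. c \<epsilon> - c0) \<in> O[at_right 0](\<lambda>\<epsilon>. \<epsilon>)"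

lemma near_tendsto: "near c c0 \<Longrightarrow> (c \<longlongrightarrow> c0) (at_right 0)"
proof -
  assume "near c c0"
  moreover have "(\<lambda>\<epsilon>::real. \<epsilon>) \<in> o[at_right 0](\<lambda>_. 1)"
    by (rule smalloI_tendsto) (auto intro!: tendsto_eq_intros)
  ultimately have "(\<lambda>\<epsilon>. c \<epsilon> - c0) \<in> o[at_right 0](\<lambda>_. 1)"
    by (rule landau_o.big_small_trans)
  then have "((\<lambda>\<epsilon>. c \<epsilon> - c0) \<longlongrightarrow> 0) (at_right 0)"
    by (auto dest: smalloD_tendsto)
  then show ?thesis by (rule LIM_zero_cancel)
qed

lemma near_bounded: "near c c0 \<Longrightarrow> c \<in> O[at_right 0](\<lambda>_. 1)"
  by (rule bigoI_tendsto[where c = c0]) (auto dest: near_tendsto)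

lemma near_const: "near (\<lambda>_. c) c"
  by simp

lemma near_ident: "near (\<lambda>\<epsilon>. \<epsilon>) 0"
  by simp

lemma near_add: "near c c0 \<Longrightarrow> near d d0 \<Longrightarrow> near (\<lambda>\<epsilon>. c \<epsilon> + d \<epsilon>) (c0 + d0)"
  using sum_in_bigo(1)[of "\<lambda>\<epsilon>. c \<epsilon> - c0" "at_right 0" "\<lambda>\<epsilon>. \<epsilon>" "\<lambda>\<epsilon>. d \<epsilon> - d0"]
  by (simp add: algebra_simps)

lemma near_mult:
  assumes "near c c0" "near d d0"
  shows "near (\<lambda>\<epsilon>. c \<epsilon> * d \<epsilon>) (c0 * d0)"
proof -
  have "(\<lambda>\<epsilon>. (c \<epsilon> - c0) * d \<epsilon>) \<in> O[at_right 0](\<lambda>\<epsilon>. \<epsilon> * 1)"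
    by (rule landau_o.big.mult[OF assms(1) near_bounded[OF assms(2)]])
  moreover have "(\<lambda>\<epsilon>. c0 * (d \<epsilon> - d0)) \<in> O[at_right 0](\<lambda>\<epsilon>. 1 * \<epsilon>)"
    by (rule landau_o.big.mult[OF _ assms(2)]) simp
  ultimately have "(\<lambda>\<epsilon>. (c \<epsilon> - c0) * d \<epsilon> + c0 * (d \<epsilon> - d0)) \<in> O[at_right 0](\<lambda>\<epsilon>. \<epsilon>)"
    by (intro sum_in_bigo) simp_all
  then show ?thesis by (simp add: algebra_simps)
qed

lemma near_inverse:
  assumes "near c c0" "c0 \<noteq> 0"
  shows "near (\<lambda>\<epsilon>. inverse (c \<epsilon>)) (inverse c0)"
proof -
  have c: "(c \<longlongrightarrow> c0) (at_right 0)" using near_tendsto[OF assms(1)] .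
  have "(\<lambda>\<epsilon>. inverse (c \<epsilon>) * inverse c0) \<in> O[at_right 0](\<lambda>_. 1)"
    by (rule bigoI_tendsto[where c = "inverse c0 * inverse c0"])
      (use assms(2) in \<open>auto intro!: tendsto_eq_intros c\<close>)
  then have "(\<lambda>\<epsilon>. (c \<epsilon> - c0) * (inverse (c \<epsilon>) * inverse c0)) \<in> O[at_right 0](\<lambda>\<epsilon>. \<epsilon> * 1)"
    by (rule landau_o.big.mult[OF assms(1)])
  then have *: "(\<lambda>\<epsilon>. - ((c \<epsilon> - c0) * (inverse (c \<epsilon>) * inverse c0))) \<in> O[at_right 0](\<lambda>\<epsilon>. \<epsilon>)"
    by simp
  have "\<forall>\<^sub>F \<epsilon> in at_right 0. c \<epsilon> \<noteq> 0"
    using tendsto_imp_eventually_ne[OF c assms(2)] .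
  then have "\<forall>\<^sub>F \<epsilon> in at_right 0. - ((c \<epsilon> - c0) * (inverse (c \<epsilon>) * inverse c0)) = inverse (c \<epsilon>) - inverse c0"
    by eventually_elim (use assms(2) in \<open>simp add: field_simps\<close>)
  from landau_o.big.in_cong[OF this] * show ?thesis by simp
qed

lemma near_divide: "near c c0 \<Longrightarrow> near d d0 \<Longrightarrow> d0 \<noteq> 0 \<Longrightarrow> near (\<lambda>\<epsilon>. c \<epsilon> / d \<epsilon>) (c0 / d0)"
  unfolding divide_inverse by (intro near_mult near_inverse)

text \<open>The coefficients \<open>a\<close> and \<open>b\<close> of the scheme have this form, with \<open>G\<close> the depth or the buoyancy.  Since \<open>G \<epsilon>\<close> is
bounded uniformly in \<open>\<epsilon>\<close>, the infimum differs from \<open>1\<close> by \<open>O(\<epsilon>)\<close>.\<close>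

lemma near_INF:
  fixes G :: "real \<Rightarrow> 'a::euclidean_space \<Rightarrow> real"
  assumes S: "open S" "S \<noteq> {}" and G: "expands S G G0"
  shows "near (\<lambda>\<epsilon>. (1 - \<epsilon>) * (INF p\<in>S. 1 + c * \<epsilon> * G \<epsilon> p)) 1"
proof -
  obtain M where M: "M > 0" "\<forall>\<^sub>F \<epsilon> in at_right 0. \<forall>p\<in>S. norm (G \<epsilon> p) \<le> M * \<bar>1\<bar>"
    using bigo_family_bounded[OF expands_bigo_1[OF S G]] by blast
  have "near (\<lambda>\<epsilon>. INF p\<in>S. 1 + c * \<epsilon> * G \<epsilon> p) 1"
  proof (rule bigoI[of _ "\<bar>c\<bar> * M"])
    show "\<forall>\<^sub>F \<epsilon> in at_right 0. norm ((INF p\<in>S. 1 + c * \<epsilon> * G \<epsilon> p) - 1) \<le> \<bar>c\<bar> * M * norm \<epsilon>"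
      using M(2)
    proof eventually_elim
      case (elim \<epsilon>)
      have b: "\<bar>c * \<epsilon> * G \<epsilon> p\<bar> \<le> \<bar>c\<bar> * M * \<bar>\<epsilon>\<bar>" if "p \<in> S" for p
      proof -
        have "\<bar>c\<bar> * \<bar>\<epsilon>\<bar> * \<bar>G \<epsilon> p\<bar> \<le> \<bar>c\<bar> * \<bar>\<epsilon>\<bar> * M" using elim that by (intro mult_left_mono) auto
        then show ?thesis by (simp add: abs_mult mult_ac)
      qed
      obtain p0 where "p0 \<in> S" using S by blast
      have "1 - \<bar>c\<bar> * M * \<bar>\<epsilon>\<bar> \<le> (INF p\<in>S. 1 + c * \<epsilon> * G \<epsilon> p)"
        using S b by (intro cINF_greatest) (auto simp: abs_le_iff dest!: b)
      moreover have "(INF p\<in>S. 1 + c * \<epsilon> * G \<epsilon> p) \<le> 1 + c * \<epsilon> * G \<epsilon> p0"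
        using b by (intro cINF_lower \<open>p0 \<in> S\<close> bdd_belowI2[of _ "1 - \<bar>c\<bar> * M * \<bar>\<epsilon>\<bar>"]) (auto dest!: b)
      ultimately show ?case using b[OF \<open>p0 \<in> S\<close>] by (auto simp: abs_le_iff)
    qed
  qed
  from near_mult[OF near_add[OF near_const[of 1] near_mult[OF near_const[of "-1"] near_ident]] this]
  show ?thesis by simp
qed

lemma near_acoef:
  assumes "open \<Omega>" "\<Omega> \<noteq> {}" "expands \<Omega> (\<lambda>\<epsilon>. dep (Z \<epsilon>)) f"
  shows "near (\<lambda>\<epsilon>. acoef \<Omega> \<epsilon> \<nu> (Z \<epsilon>)) 1"
  using near_INF[OF assms, of "1 / \<nu>"] unfolding acoef_def hgt_def by simp

lemma near_bcoef:
  assumes "open \<Omega>" "\<Omega> \<noteq> {}" "expands \<Omega> (\<lambda>\<epsilon>. buo (Z \<epsilon>)) f"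
  shows "near (\<lambda>\<epsilon>. bcoef \<Omega> \<epsilon> \<nu> (Z \<epsilon>)) 1"
  using near_INF[OF assms, of "2 / \<nu>"] unfolding bcoef_def Tht_def by simp

section \<open>Expansions under the planar operators\<close>

context
  fixes \<Omega> :: "(real \<times> real) set"
  assumes \<Omega>: "open \<Omega>" "\<Omega> \<noteq> {}"
begin

lemma expands_mult:
  "expands \<Omega> F F0 \<Longrightarrow> expands \<Omega> G G0 \<Longrightarrow> expands \<Omega> (\<lambda>\<epsilon> p. F \<epsilon> p * G \<epsilon> p :: real) (\<lambda>p. F0 p * G0 p)"
  by (rule expands_bilinear[OF \<Omega> bounded_bilinear_mult])

lemma expands_scaleR:
  "expands \<Omega> F F0 \<Longrightarrow> expands \<Omega> G G0 \<Longrightarrow> expands \<Omega> (\<lambda>\<epsilon> p. F \<epsilon> p *\<^sub>R G \<epsilon> p) (\<lambda>p. F0 p *\<^sub>R G0 p)"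
  by (rule expands_bilinear[OF \<Omega> bounded_bilinear_scaleR])

lemma expands_Pair:
  assumes "expands \<Omega> F F0" "expands \<Omega> G G0"
  shows "expands \<Omega> (\<lambda>\<epsilon> p. (F \<epsilon> p, G \<epsilon> p)) (\<lambda>p. (F0 p, G0 p))"
  using expands_add[OF \<Omega> expands_bounded_linear[OF \<Omega> bounded_linear_Pair[OF bounded_linear_ident bounded_linear_zero] assms(1)]
      expands_bounded_linear[OF \<Omega> bounded_linear_Pair[OF bounded_linear_zero bounded_linear_ident] assms(2)]]
  by simp

lemmas expands_fst = expands_bounded_linear[OF \<Omega> bounded_linear_fst]
lemmas expands_snd = expands_bounded_linear[OF \<Omega> bounded_linear_snd]
lemmas expands_dx = expands_pdiff[OF \<Omega> plane_Basis(1)]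
lemmas expands_dy = expands_pdiff[OF \<Omega> plane_Basis(2)]

lemma expands_uminus: "expands \<Omega> F F0 \<Longrightarrow> expands \<Omega> (\<lambda>\<epsilon> p. - F \<epsilon> p) (\<lambda>p. - F0 p)"
  by (rule expands_bounded_linear[OF \<Omega> bounded_linear_minus[OF bounded_linear_ident]])

lemma expands_advect:
  assumes "expands \<Omega> V V0" "expands \<Omega> F F0"
  shows "expands \<Omega> (\<lambda>\<epsilon>. advect (V \<epsilon>) (F \<epsilon>)) (advect V0 F0)"
  unfolding advect_def[abs_def]
  by (intro expands_add[OF \<Omega>] expands_scaleR expands_fst expands_snd expands_dx expands_dy assms)

lemma expands_grad: "expands \<Omega> F F0 \<Longrightarrow> expands \<Omega> (\<lambda>\<epsilon>. grad (F \<epsilon>)) (grad F0)"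
  unfolding grad_def[abs_def] by (intro expands_Pair expands_dx expands_dy)

lemma expands_divergence: "expands \<Omega> V V0 \<Longrightarrow> expands \<Omega> (\<lambda>\<epsilon>. divergence (V \<epsilon>)) (divergence V0)"
  unfolding divergence_def[abs_def]
  by (intro expands_add[OF \<Omega>] expands_fst expands_snd expands_dx expands_dy)

lemma expands_jacobian:
  "expands \<Omega> F F0 \<Longrightarrow> expands \<Omega> G G0 \<Longrightarrow> expands \<Omega> (\<lambda>\<epsilon>. jacobian (F \<epsilon>) (G \<epsilon>)) (jacobian F0 G0)"
  unfolding jacobian_def[abs_def]
  by (intro expands_diff[OF \<Omega>] expands_mult expands_dx expands_dy)

lemma expands_perp: "expands \<Omega> V V0 \<Longrightarrow> expands \<Omega> (\<lambda>\<epsilon> p. perp (V \<epsilon> p)) (\<lambda>p. perp (V0 p))"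
  unfolding perp_def by (intro expands_Pair expands_uminus expands_fst expands_snd)

lemmas expands_rules = expands_add[OF \<Omega>] expands_diff[OF \<Omega>] expands_uminus expands_mult expands_scaleR
  expands_perp expands_const[OF \<Omega>]

end

lemma pdiff_Pair:
  assumes "open S" "f differentiable_on S" "g differentiable_on S" "p \<in> S"
  shows "pdiff e (\<lambda>p. (f p, g p)) p = (pdiff e f p, pdiff e g p)"
  using pdiff_eqI[OF has_derivative_Pair[OF has_derivative_frechet has_derivative_frechet]] assms
  by (force simp: pdiff_def)

text \<open>The leading-order velocity is nondivergent, which removes the term \<open>q \<nabla>\<cdot>v\<close> from the limit of the
potential vorticity equation.\<close>

lemma divergence_grad_perp:
  assumes "open \<Omega>" "smooth_bounded \<Omega> \<psi>" "p \<in> \<Omega>"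
  shows "divergence (grad_perp \<psi>) p = 0"
proof -
  have sm: "smooth_bounded \<Omega> (dx \<psi>)" "smooth_bounded \<Omega> (dy \<psi>)" "smooth_bounded \<Omega> (dx (dy \<psi>))" "smooth_bounded \<Omega> (dy (dx \<psi>))"
    by (intro smooth_bounded_pdiff plane_Basis assms)+
  note d = sm[THEN smooth_bounded_differentiable] smooth_bounded_differentiable[OF assms(2)]
  have "(\<lambda>p. - dy \<psi> p) differentiable_on \<Omega>" using d by simp
  moreover have "dx (\<lambda>p. - dy \<psi> p) p = - dx (dy \<psi>) p"
    by (rule pdiff_bounded_linear[OF bounded_linear_minus[OF bounded_linear_ident] assms(1) d(2) assms(3)])
  ultimately have "divergence (grad_perp \<psi>) p = - dx (dy \<psi>) p + dy (dx \<psi>) p"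
    using d assms unfolding divergence_def grad_perp_def[abs_def] by (simp add: pdiff_Pair[OF assms(1)])
  moreover have "dx (dy \<psi>) p = dy (dx \<psi>) p"
    by (rule mixed_partials_commute[OF assms(1,3)]) (auto intro: d differentiable_imp_continuous_on)
  ultimately show ?thesis by simp
qed

lemma divergence_cong:
  assumes "open \<Omega>" "p \<in> \<Omega>" "\<And>p. p \<in> \<Omega> \<Longrightarrow> v p = w p"
  shows "divergence v p = divergence w p"
  unfolding divergence_def using pdiff_cong[OF assms(1,2), of v w] assms(3) by simp

lemma divergence_scaleR:
  assumes "open \<Omega>" "smooth_bounded \<Omega> v" "p \<in> \<Omega>"
  shows "divergence (\<lambda>p. c *\<^sub>R v p) p = c * divergence v p"
  unfolding divergence_def
  by (simp add: pdiff_bounded_linear[OF bounded_linear_scaleR_right assms(1) smooth_bounded_differentiable[OF assms(2)] assms(3)] distrib_left)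

section \<open>One step of the scheme\<close>

text \<open>Since \<^const>\<open>perp\<close> squares to \<open>-1\<close>, the operator \<open>\<epsilon> + B perp\<close> has the conjugate inverse
\<open>(\<epsilon> - B perp) / (\<epsilon>\<^sup>2 + B\<^sup>2)\<close>, which tends to \<open>- perp / B\<close> as \<open>\<epsilon> \<rightarrow> 0\<close>.\<close>

lemma rotated_system_solution:
  assumes "\<epsilon> * \<epsilon> + B * B \<noteq> (0 :: real)" "\<epsilon> *\<^sub>R w + B *\<^sub>R perp w = g"
  shows "w = (\<epsilon> / (\<epsilon> * \<epsilon> + B * B)) *\<^sub>R g - (B / (\<epsilon> * \<epsilon> + B * B)) *\<^sub>R perp g"
proof -
  let ?D = "\<epsilon> * \<epsilon> + B * B"
  have "?D *\<^sub>R w = \<epsilon> *\<^sub>R g - B *\<^sub>R perp g"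
    by (simp add: prod_eq_iff perp_def algebra_simps flip: assms(2))
  then have "(1 / ?D) *\<^sub>R (?D *\<^sub>R w) = (1 / ?D) *\<^sub>R (\<epsilon> *\<^sub>R g - B *\<^sub>R perp g)" by simp
  then show ?thesis
    using assms(1) by (auto simp: scaleR_diff_right split: if_splits)
qed

text \<open>Applied to \<open>\<phi> = \<psi> - \<theta>\<close>, this replaces \<open>[\<phi>, \<theta>]\<close> by \<open>[\<psi>, \<theta>]\<close>.\<close>

lemma jacobian_diff_self:
  assumes "open \<Omega>" "smooth_bounded \<Omega> f" "smooth_bounded \<Omega> g" "p \<in> \<Omega>"
  shows "jacobian (\<lambda>p. f p - g p) g p = jacobian f g p"
proof -
  have eq: "dx (\<lambda>p. f p - g p) p = dx f p - dx g p" "dy (\<lambda>p. f p - g p) p = dy f p - dy g p"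
    using partials_diff[OF assms(1-3), of "[(1, 0)]" p] partials_diff[OF assms(1-3), of "[(0, 1)]" p]
      assms(4) plane_Basis by simp_all
  show ?thesis unfolding jacobian_def by (simp only: eq) (simp add: algebra_simps)
qed

text \<open>The transport updates are polynomial in the old state and its derivatives, so they expand term by term.
The nonstiff terms divide by \<open>\<epsilon>\<close>, but the scheme uses them only through \<open>\<epsilon> R\<close>; there the quotients
disappear and the coefficients \<open>\<Theta> - b\<close>, \<open>h - b\<close>, \<open>h - a\<close> and \<open>1 + \<epsilon> \<beta> y - b\<close> vanish in the limit.  After division by
\<open>a b dt\<^sup>2\<close> the elliptic equation falls under \<open>elliptic_limit\<close>, and its limit says that \<open>\<Delta>\<psi>\<close> is the new
vorticity.  The momentum equation is then solved explicitly, and its limit is geostrophic balance.\<close>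

lemma SI_step_preserves_expansion:
  fixes Z Z' :: "real \<Rightarrow> trsw"
  assumes domain: "open \<Omega>" "\<Omega> \<noteq> {}" "bounded \<Omega>"
    and params: "\<nu> > 0" "dt > 0"
    and stable: "elliptic_stable \<Omega> \<nu> B"
    and step: "\<forall>\<^sub>F \<epsilon> in at_right 0. SI_step \<Omega> B \<epsilon> \<nu> \<beta> dt (Z \<epsilon>) (Z' \<epsilon>)"
    and Z: "expands_state \<Omega> \<nu> \<beta> Z y"
    and geo: "geostrophic \<Omega> y"
  shows "\<exists>y'. expands_state \<Omega> \<nu> \<beta> Z' y' \<and> geostrophic \<Omega> y' \<and> (\<forall>p\<in>\<Omega>. TQG_defect \<nu> \<beta> dt y y' p = 0)"
proof -
  note \<Omega> = domain(1,2)
  note intros = expands_rules[OF \<Omega>]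
  have pos: "\<forall>\<^sub>F \<epsilon>::real in at_right 0. 0 < \<epsilon>" by (rule eventually_at_right_less)

  have vel: "expands \<Omega> (\<lambda>\<epsilon>. vel (Z \<epsilon>)) (vel0 y)"
    and vort: "expands \<Omega> (\<lambda>\<epsilon>. vorticity \<nu> \<beta> (Z \<epsilon>)) (vort0 y)"
    and psi: "expands \<Omega> (\<lambda>\<epsilon>. stream (Z \<epsilon>)) (psi0 y)"
    and buo: "expands \<Omega> (\<lambda>\<epsilon>. buo (Z \<epsilon>)) (theta0 y)"
    using Z unfolding expands_state_def by auto
  have y: "expands \<Omega> (\<lambda>_. snd) snd"
    by (intro expands_fixed[OF \<Omega>] smooth_bounded_linear_map domain bounded_linear_snd)
  have dep: "expands \<Omega> (\<lambda>\<epsilon>. dep (Z \<epsilon>)) (phi0 y)"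
  proof -
    have "expands \<Omega> (\<lambda>\<epsilon> p. stream (Z \<epsilon>) p - buo (Z \<epsilon>) p) (\<lambda>p. psi0 y p - theta0 y p)"
      by (intro intros psi buo)
    then show ?thesis by (simp add: stream_def phi0_def[abs_def])
  qed
  have pvt: "expands \<Omega> (\<lambda>\<epsilon>. pvt (Z \<epsilon>)) (q0 \<nu> \<beta> y)"
  proof -
    have "expands \<Omega> (\<lambda>\<epsilon> p. vorticity \<nu> \<beta> (Z \<epsilon>) p + \<beta> * snd p - 1 / \<nu> * dep (Z \<epsilon>) p)
        (\<lambda>p. vort0 y p + \<beta> * snd p - 1 / \<nu> * phi0 y p)"
      by (intro intros vort dep y)
    then show ?thesis by (simp add: vorticity_def q0_def[abs_def])
  qed

  let ?a = "\<lambda>\<epsilon>. acoef \<Omega> \<epsilon> \<nu> (Z \<epsilon>)" and ?b = "\<lambda>\<epsilon>. bcoef \<Omega> \<epsilon> \<nu> (Z \<epsilon>)"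
  have a: "near ?a 1" by (rule near_acoef[OF \<Omega> dep])
  have b: "near ?b 1" by (rule near_bcoef[OF \<Omega> buo])
  note coeff = expands_coeff[OF \<Omega>]

  define \<theta>1 where "\<theta>1 p = theta0 y p - dt * advect (vel0 y) (theta0 y) p" for p
  have buo': "expands \<Omega> (\<lambda>\<epsilon>. buo (Z' \<epsilon>)) \<theta>1"
  proof (rule expands_cong[OF \<Omega>])
    show "expands \<Omega> (\<lambda>\<epsilon> p. buo (Z \<epsilon>) p - dt * advect (vel (Z \<epsilon>)) (buo (Z \<epsilon>)) p)
        (\<lambda>p. theta0 y p - dt * advect (vel0 y) (theta0 y) p)"
      by (intro intros expands_advect[OF \<Omega>] buo vel)
    show "\<forall>\<^sub>F \<epsilon> in at_right 0. \<forall>p\<in>\<Omega>. buo (Z \<epsilon>) p - dt * advect (vel (Z \<epsilon>)) (buo (Z \<epsilon>)) p = buo (Z' \<epsilon>) p"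
      using step by eventually_elim (simp add: SI_step_def Rtheta_def)
  qed (simp add: \<theta>1_def)
  define q1 where "q1 p = q0 \<nu> \<beta> y p - dt * (advect (vel0 y) (q0 \<nu> \<beta> y) p
      + q0 \<nu> \<beta> y p * divergence (vel0 y) p - 1 / \<nu> * jacobian (phi0 y) (theta0 y) p)" for p
  have pvt': "expands \<Omega> (\<lambda>\<epsilon>. pvt (Z' \<epsilon>)) q1"
  proof (rule expands_cong[OF \<Omega>])
    show "expands \<Omega> (\<lambda>\<epsilon> p. pvt (Z \<epsilon>) p - dt * (advect (vel (Z \<epsilon>)) (pvt (Z \<epsilon>)) p
        + pvt (Z \<epsilon>) p * divergence (vel (Z \<epsilon>)) p - 1 / \<nu> * jacobian (dep (Z \<epsilon>)) (buo (Z \<epsilon>)) p))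
       (\<lambda>p. q0 \<nu> \<beta> y p - dt * (advect (vel0 y) (q0 \<nu> \<beta> y) p
        + q0 \<nu> \<beta> y p * divergence (vel0 y) p - 1 / \<nu> * jacobian (phi0 y) (theta0 y) p))"
      by (intro intros expands_advect[OF \<Omega>] expands_divergence[OF \<Omega>] expands_jacobian[OF \<Omega>] buo vel pvt dep)
    show "\<forall>\<^sub>F \<epsilon> in at_right 0. \<forall>p\<in>\<Omega>. pvt (Z \<epsilon>) p - dt * (advect (vel (Z \<epsilon>)) (pvt (Z \<epsilon>)) p
        + pvt (Z \<epsilon>) p * divergence (vel (Z \<epsilon>)) p - 1 / \<nu> * jacobian (dep (Z \<epsilon>)) (buo (Z \<epsilon>)) p)
        = pvt (Z' \<epsilon>) p"
      using step by eventually_elim (simp add: SI_step_def Rq_def)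
  qed (simp add: q1_def)

  \<comment> \<open>\<open>R\<close> and \<open>P\<close> are \<open>\<epsilon>\<close> times the nonstiff terms, written without any division by \<open>\<epsilon>\<close>.\<close>
  have Tht: "expands \<Omega> (\<lambda>\<epsilon>. Tht \<epsilon> \<nu> (Z \<epsilon>)) (\<lambda>_. 1)"
  proof -
    have "near (\<lambda>\<epsilon>. 2 / \<nu> * \<epsilon>) (2 / \<nu> * 0)" by (intro near_mult near_const near_ident)
    then have "expands \<Omega> (\<lambda>\<epsilon> p. 1 + 2 / \<nu> * \<epsilon> * buo (Z \<epsilon>) p) (\<lambda>p. 1 + 2 / \<nu> * 0 * theta0 y p)"
      by (intro expands_add[OF \<Omega>] expands_mult[OF \<Omega>] expands_const[OF \<Omega>] coeff buo)
    then show ?thesis by (simp add: Tht_def[abs_def])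
  qed
  have hgt: "expands \<Omega> (\<lambda>\<epsilon>. hgt \<epsilon> \<nu> (Z \<epsilon>)) (\<lambda>_. 1)"
  proof -
    have "near (\<lambda>\<epsilon>. 1 / \<nu> * \<epsilon>) (1 / \<nu> * 0)" by (intro near_mult near_const near_ident)
    then have "expands \<Omega> (\<lambda>\<epsilon> p. 1 + 1 / \<nu> * \<epsilon> * dep (Z \<epsilon>) p) (\<lambda>p. 1 + 1 / \<nu> * 0 * phi0 y p)"
      by (intro expands_add[OF \<Omega>] expands_mult[OF \<Omega>] expands_const[OF \<Omega>] coeff dep)
    then show ?thesis by (simp add: hgt_def[abs_def])
  qed
  define R where "R \<epsilon> p = \<epsilon> *\<^sub>R advect (vel (Z \<epsilon>)) (vel (Z \<epsilon>)) p
      + (Tht \<epsilon> \<nu> (Z \<epsilon>) p - ?b \<epsilon>) *\<^sub>R grad (dep (Z \<epsilon>)) p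
      + (hgt \<epsilon> \<nu> (Z \<epsilon>) p - ?b \<epsilon>) *\<^sub>R grad (buo (Z \<epsilon>)) p
      + (1 + \<epsilon> * (\<beta> * snd p) - ?b \<epsilon>) *\<^sub>R perp (vel (Z \<epsilon>) p)" for \<epsilon> p
  have R: "expands \<Omega> R (\<lambda>_. 0)"
  proof -
    have "expands \<Omega> R (\<lambda>p. 0 *\<^sub>R advect (vel0 y) (vel0 y) p + (1 - 1) *\<^sub>R grad (phi0 y) p
        + (1 - 1) *\<^sub>R grad (theta0 y) p + (1 + 0 * (\<beta> * snd p) - 1) *\<^sub>R perp (vel0 y p))"
      unfolding R_def[abs_def]
      by (intro expands_add[OF \<Omega>] expands_diff[OF \<Omega>] expands_scaleR[OF \<Omega>] expands_mult[OF \<Omega>]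
          expands_perp[OF \<Omega>] expands_advect[OF \<Omega>] expands_grad[OF \<Omega>]
          expands_const[OF \<Omega>] coeff[OF near_ident] coeff[OF b] Tht hgt vel dep buo y)
    then show ?thesis by simp
  qed
  have R_eq: "R \<epsilon> p = \<epsilon> *\<^sub>R Rv \<Omega> \<epsilon> \<nu> \<beta> (Z \<epsilon>) p" if "0 < \<epsilon>" for \<epsilon> p
    using that by (simp add: R_def Rv_def scaleR_add_right mult.assoc)
  define P where "P \<epsilon> p = \<epsilon> * advect (vel (Z \<epsilon>)) (dep (Z \<epsilon>)) p
      + \<nu> * (hgt \<epsilon> \<nu> (Z \<epsilon>) p - ?a \<epsilon>) * divergence (vel (Z \<epsilon>)) p
      + \<epsilon> * advect (vel (Z \<epsilon>)) (buo (Z \<epsilon>)) p" for \<epsilon> p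
  have P: "expands \<Omega> P (\<lambda>_. 0)"
  proof -
    have "expands \<Omega> P (\<lambda>p. 0 * advect (vel0 y) (phi0 y) p + \<nu> * (1 - 1) * divergence (vel0 y) p
        + 0 * advect (vel0 y) (theta0 y) p)"
      unfolding P_def[abs_def]
      by (intro expands_add[OF \<Omega>] expands_diff[OF \<Omega>] expands_mult[OF \<Omega>] expands_advect[OF \<Omega>]
          expands_divergence[OF \<Omega>] expands_const[OF \<Omega>] coeff[OF near_ident] coeff[OF a] hgt vel dep buo)
    then show ?thesis by simp
  qed
  have P_eq: "P \<epsilon> p = \<epsilon> * Rpsi \<Omega> \<epsilon> \<nu> (Z \<epsilon>) p" if "0 < \<epsilon>" for \<epsilon> p
    using that by (simp add: P_def Rpsi_def Rphi_def Rtheta_def distrib_left)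

  \<comment> \<open>The elliptic equation is divided by \<open>D = a b dt\<^sup>2\<close>.  Near \<open>\<epsilon> = 0\<close> this is positive, so \<open>\<mu> \<ge> 1\<close> as stability requires.\<close>
  define D where "D \<epsilon> = ?a \<epsilon> * ?b \<epsilon> * dt\<^sup>2" for \<epsilon>
  have D: "near D (1 * 1 * dt\<^sup>2)"
    unfolding D_def[abs_def] by (intro near_mult near_const a b)
  have D_pos: "\<forall>\<^sub>F \<epsilon> in at_right 0. 0 < D \<epsilon>"
    using order_tendstoD(1)[OF near_tendsto[OF D], of 0] params by simp
  have dt2: "1 * 1 * dt\<^sup>2 \<noteq> 0" using params by simp
  define \<mu> where "\<mu> \<epsilon> = 1 + \<epsilon> * \<epsilon> / D \<epsilon>" for \<epsilon>
  have "near \<mu> (1 + 0 * 0 / (1 * 1 * dt\<^sup>2))"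
    unfolding \<mu>_def[abs_def] by (intro near_add near_divide near_mult near_const near_ident D dt2)
  then have \<mu>: "near \<mu> 1" by simp
  define f where "f \<epsilon> p = - (\<nu> * pvt (Z' \<epsilon>) p - \<nu> * \<beta> * snd p - buo (Z' \<epsilon>) p)
      - \<nu> * ?a \<epsilon> * dt / D \<epsilon> * (\<epsilon> * divergence (vel (Z \<epsilon>)) p - dt * divergence (R \<epsilon>) p)
      + \<epsilon> / D \<epsilon> * (\<epsilon> * stream (Z \<epsilon>) p - dt * P \<epsilon> p)" for \<epsilon> p
  define f0 where "f0 p = - (\<nu> * q1 p - \<nu> * \<beta> * snd p - \<theta>1 p)" for p
  have f: "expands \<Omega> f f0"
  proof -
    have c1: "near (\<lambda>\<epsilon>. \<nu> * ?a \<epsilon> * dt / D \<epsilon>) (\<nu> * 1 * dt / (1 * 1 * dt\<^sup>2))"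
      by (intro near_divide near_mult near_const a D dt2)
    have c2: "near (\<lambda>\<epsilon>. \<epsilon> / D \<epsilon>) (0 / (1 * 1 * dt\<^sup>2))"
      by (intro near_divide near_ident D dt2)
    have "expands \<Omega> f (\<lambda>p. - (\<nu> * q1 p - \<nu> * \<beta> * snd p - \<theta>1 p)
      - \<nu> * 1 * dt / (1 * 1 * dt\<^sup>2) * (0 * divergence (vel0 y) p - dt * divergence (\<lambda>_. 0) p)
      + 0 / (1 * 1 * dt\<^sup>2) * (0 * psi0 y p - dt * 0))"
      unfolding f_def[abs_def]
      by (intro expands_add[OF \<Omega>] expands_diff[OF \<Omega>] expands_uminus[OF \<Omega>]
          expands_mult[OF \<Omega> expands_mult[OF \<Omega> expands_const[OF \<Omega>] expands_const[OF \<Omega>]] y]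
          expands_mult[OF \<Omega> coeff[OF c1]] expands_mult[OF \<Omega> coeff[OF c2]]
          expands_mult[OF \<Omega> coeff[OF near_ident]] expands_mult[OF \<Omega> expands_const[OF \<Omega>]]
          expands_divergence[OF \<Omega>] pvt' buo' vel R P psi)
    then show ?thesis by (simp add: divergence_def f0_def[abs_def])
  qed
  have R_smooth: "\<forall>\<^sub>F \<epsilon> in at_right 0. smooth_bounded \<Omega> (R \<epsilon>)"
    using R unfolding expands_def by blast
  have "\<exists>\<psi>1. expands \<Omega> (\<lambda>\<epsilon>. stream (Z' \<epsilon>)) \<psi>1 \<and> (\<forall>p\<in>\<Omega>. \<psi>1 p - \<nu> * laplacian \<psi>1 p = f0 p)"
  proof (rule elliptic_limit[OF \<Omega> stable _ _ \<mu> f])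
    show "\<forall>\<^sub>F \<epsilon> in at_right 0. 1 \<le> \<mu> \<epsilon>"
      using D_pos by eventually_elim (simp add: \<mu>_def)
    show "\<forall>\<^sub>F \<epsilon> in at_right 0. stream (Z' \<epsilon>) \<in> B \<and> smooth_bounded \<Omega> (stream (Z' \<epsilon>)) \<and>
        (\<forall>p\<in>\<Omega>. \<mu> \<epsilon> * stream (Z' \<epsilon>) p - \<nu> * laplacian (stream (Z' \<epsilon>)) p = f \<epsilon> p)"
      using step pos D_pos R_smooth
    proof eventually_elim
      case (elim \<epsilon>)
      have "\<mu> \<epsilon> * stream (Z' \<epsilon>) p - \<nu> * laplacian (stream (Z' \<epsilon>)) p = f \<epsilon> p" if p: "p \<in> \<Omega>" for p
      proof -
        have "Rv \<Omega> \<epsilon> \<nu> \<beta> (Z \<epsilon>) = (\<lambda>p. (1 / \<epsilon>) *\<^sub>R R \<epsilon> p)"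
          using R_eq elim(2) by auto
        then have divR: "\<epsilon> * divergence (Rv \<Omega> \<epsilon> \<nu> \<beta> (Z \<epsilon>)) p = divergence (R \<epsilon>) p"
          using divergence_scaleR[OF \<Omega>(1) elim(4) p, of "1 / \<epsilon>"] elim(2) by simp
        have "(\<epsilon>\<^sup>2 + D \<epsilon>) * stream (Z' \<epsilon>) p - \<nu> * D \<epsilon> * laplacian (stream (Z' \<epsilon>)) p
            = elliptic_rhs \<Omega> \<epsilon> \<nu> \<beta> dt (Z \<epsilon>) (Z' \<epsilon>) p"
          using elim(1) p by (simp add: SI_step_def D_def mult.assoc)
        also have "\<dots> = - D \<epsilon> * (\<nu> * pvt (Z' \<epsilon>) p - \<nu> * \<beta> * snd p - buo (Z' \<epsilon>) p)
            - \<nu> * ?a \<epsilon> * dt * (\<epsilon> * divergence (vel (Z \<epsilon>)) p - dt * divergence (R \<epsilon>) p)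
            + \<epsilon> * (\<epsilon> * stream (Z \<epsilon>) p - dt * P \<epsilon> p)"
          unfolding elliptic_rhs_def D_def divR[symmetric] P_eq[OF elim(2)]
          by (simp add: algebra_simps power2_eq_square)
        also have "\<dots> = D \<epsilon> * f \<epsilon> p"
          using elim(3) by (simp add: f_def algebra_simps)
        finally have "D \<epsilon> * (\<mu> \<epsilon> * stream (Z' \<epsilon>) p - \<nu> * laplacian (stream (Z' \<epsilon>)) p) = D \<epsilon> * f \<epsilon> p"
          using elim(3) by (simp add: \<mu>_def algebra_simps power2_eq_square)
        then show ?thesis using elim(3) by simp
      qed
      with elim(1) show ?case by (simp add: SI_step_def)
    qed
  qed
  then obtain \<psi>1 where \<psi>1: "expands \<Omega> (\<lambda>\<epsilon>. stream (Z' \<epsilon>)) \<psi>1"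
    and \<psi>1_eq: "\<And>p. p \<in> \<Omega> \<Longrightarrow> \<psi>1 p - \<nu> * laplacian \<psi>1 p = f0 p" by blast

  \<comment> \<open>The limits below keep the unsimplified shape that the closure rules produce, e.g. \<open>1 * dt\<close> for the
    limit of \<open>b dt\<close>.\<close>
  define G where "G \<epsilon> p = \<epsilon> *\<^sub>R vel (Z \<epsilon>) p - dt *\<^sub>R R \<epsilon> p - (?b \<epsilon> * dt) *\<^sub>R grad (stream (Z' \<epsilon>)) p" for \<epsilon> p
  have bdt: "near (\<lambda>\<epsilon>. ?b \<epsilon> * dt) (1 * dt)" by (intro near_mult near_const b)
  have G: "expands \<Omega> G (\<lambda>p. 0 *\<^sub>R vel0 y p - dt *\<^sub>R 0 - (1 * dt) *\<^sub>R grad \<psi>1 p)"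
    unfolding G_def[abs_def]
    by (intro expands_diff[OF \<Omega>] expands_scaleR[OF \<Omega> coeff[OF near_ident]]
        expands_scaleR[OF \<Omega> coeff[OF bdt]] expands_scaleR[OF \<Omega> expands_const[OF \<Omega>]]
        expands_grad[OF \<Omega>] vel R \<psi>1)
  define E where "E \<epsilon> = \<epsilon> * \<epsilon> + (?b \<epsilon> * dt) * (?b \<epsilon> * dt)" for \<epsilon>
  have E: "near E (0 * 0 + (1 * dt) * (1 * dt))"
    unfolding E_def[abs_def] by (intro near_add near_mult[OF bdt bdt] near_mult[OF near_ident near_ident])
  have E0: "0 * 0 + (1 * dt) * (1 * dt) \<noteq> 0" using params by simp
  have vel': "expands \<Omega> (\<lambda>\<epsilon>. vel (Z' \<epsilon>)) (grad_perp \<psi>1)"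
  proof (rule expands_cong[OF \<Omega>])
    have c1: "near (\<lambda>\<epsilon>. \<epsilon> / E \<epsilon>) (0 / (0 * 0 + (1 * dt) * (1 * dt)))"
      by (intro near_divide near_ident E E0)
    have c2: "near (\<lambda>\<epsilon>. ?b \<epsilon> * dt / E \<epsilon>) (1 * dt / (0 * 0 + (1 * dt) * (1 * dt)))"
      by (intro near_divide bdt E E0)
    let ?G0 = "\<lambda>p. 0 *\<^sub>R vel0 y p - dt *\<^sub>R 0 - (1 * dt) *\<^sub>R grad \<psi>1 p"
    show "expands \<Omega> (\<lambda>\<epsilon> p. (\<epsilon> / E \<epsilon>) *\<^sub>R G \<epsilon> p - (?b \<epsilon> * dt / E \<epsilon>) *\<^sub>R perp (G \<epsilon> p))
        (\<lambda>p. (0 / (0 * 0 + (1 * dt) * (1 * dt))) *\<^sub>R ?G0 p - (1 * dt / (0 * 0 + (1 * dt) * (1 * dt))) *\<^sub>R perp (?G0 p))"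
      by (rule expands_diff[OF \<Omega> expands_scaleR[OF \<Omega> coeff[OF c1] G]
            expands_scaleR[OF \<Omega> coeff[OF c2] expands_perp[OF \<Omega> G]]])
    show "(0 / (0 * 0 + (1 * dt) * (1 * dt))) *\<^sub>R ?G0 p - (1 * dt / (0 * 0 + (1 * dt) * (1 * dt))) *\<^sub>R perp (?G0 p)
        = grad_perp \<psi>1 p" for p
      using params by (simp add: perp_def grad_def grad_perp_def)
    show "\<forall>\<^sub>F \<epsilon> in at_right 0. \<forall>p\<in>\<Omega>. (\<epsilon> / E \<epsilon>) *\<^sub>R G \<epsilon> p - (?b \<epsilon> * dt / E \<epsilon>) *\<^sub>R perp (G \<epsilon> p) = vel (Z' \<epsilon>) p"
      using step pos
    proof eventually_elim
      case (elim \<epsilon>)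
      show ?case
      proof
        fix p assume "p \<in> \<Omega>"
        then have "\<epsilon> *\<^sub>R vel (Z' \<epsilon>) p + (?b \<epsilon> * dt) *\<^sub>R perp (vel (Z' \<epsilon>) p) = G \<epsilon> p"
          using elim(1) by (simp add: SI_step_def G_def R_eq[OF elim(2)] mult.commute)
        moreover have "E \<epsilon> \<noteq> 0" using elim(2) by (simp add: E_def add_pos_nonneg less_imp_neq[symmetric])
        ultimately show "(\<epsilon> / E \<epsilon>) *\<^sub>R G \<epsilon> p - (?b \<epsilon> * dt / E \<epsilon>) *\<^sub>R perp (G \<epsilon> p) = vel (Z' \<epsilon>) p"
          using rotated_system_solution[of \<epsilon> "?b \<epsilon> * dt" "vel (Z' \<epsilon>) p" "G \<epsilon> p"] unfolding E_def by simp
      qed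
    qed
  qed

  have lap: "laplacian \<psi>1 p = q1 p - \<beta> * snd p + 1 / \<nu> * (\<psi>1 p - \<theta>1 p)" if "p \<in> \<Omega>" for p
    using \<psi>1_eq[OF that] params unfolding f0_def by (simp add: field_simps)
  have vort': "expands \<Omega> (\<lambda>\<epsilon>. vorticity \<nu> \<beta> (Z' \<epsilon>)) (laplacian \<psi>1)"
  proof (rule expands_cong[OF \<Omega>])
    show "expands \<Omega> (\<lambda>\<epsilon> p. pvt (Z' \<epsilon>) p - \<beta> * snd p + 1 / \<nu> * (stream (Z' \<epsilon>) p - buo (Z' \<epsilon>) p))
        (\<lambda>p. q1 p - \<beta> * snd p + 1 / \<nu> * (\<psi>1 p - \<theta>1 p))"
      by (intro intros pvt' y \<psi>1 buo')
  qed (use lap in \<open>auto simp: vorticity_def stream_def\<close>)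
  define y' where "y' = \<lparr>vel0 = grad_perp \<psi>1, vort0 = laplacian \<psi>1, psi0 = \<psi>1, theta0 = \<theta>1\<rparr>"
  have "expands_state \<Omega> \<nu> \<beta> Z' y'"
    unfolding expands_state_def y'_def using vel' vort' \<psi>1 buo' by simp
  moreover have "geostrophic \<Omega> y'"
    by (simp add: geostrophic_def y'_def)
  moreover have "TQG_defect \<nu> \<beta> dt y y' p = 0" if p: "p \<in> \<Omega>" for p
  proof -
    have "q0 \<nu> \<beta> y' p = q1 p"
      using lap[OF p] by (simp add: q0_def phi0_def y'_def diff_divide_distrib)
    moreover have "divergence (vel0 y) p = 0"
    proof -
      have "divergence (vel0 y) p = divergence (grad_perp (psi0 y)) p"
        using geo by (intro divergence_cong[OF \<Omega>(1) p]) (simp add: geostrophic_def)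
      also have "\<dots> = 0"
        using psi by (intro divergence_grad_perp[OF \<Omega>(1) _ p]) (simp add: expands_def)
      finally show ?thesis .
    qed
    moreover have "jacobian (phi0 y) (theta0 y) p = jacobian (psi0 y) (theta0 y) p"
      unfolding phi0_def[abs_def]
      using psi buo by (intro jacobian_diff_self[OF \<Omega>(1) _ _ p]) (simp_all add: expands_def)
    ultimately show ?thesis
      using params by (simp add: TQG_defect_def zero_prod_def y'_def[THEN arg_cong[where f = psi0]]
          y'_def[THEN arg_cong[where f = vel0]] y'_def[THEN arg_cong[where f = vort0]]
          y'_def[THEN arg_cong[where f = theta0]] \<theta>1_def q1_def)
  qed
  ultimately show ?thesis by blast
qed

section \<open>Truncation error of the limiting scheme\<close>

text \<open>The quotient equals the time derivative at an intermediate time, and the second time derivative is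
bounded on the whole space-time cylinder, which makes \<open>M\<close> independent of \<open>t\<close> and \<open>p\<close>.\<close>

lemma forward_difference_consistent:
  fixes g :: "real \<Rightarrow> 'a::euclidean_space \<Rightarrow> real"
  assumes "open \<Omega>" and g: "smooth_bounded ({0<..<T} \<times> \<Omega>) (\<lambda>(t, p). g t p)"
  shows "\<exists>M\<ge>0. \<forall>t dt. 0 < t \<longrightarrow> 0 < dt \<longrightarrow> t + dt < T \<longrightarrow> (\<forall>p\<in>\<Omega>.
           \<bar>(g (t + dt) p - g t p) / dt - deriv (\<lambda>\<tau>. g \<tau> p) t\<bar> \<le> M * dt)"
proof -
  let ?S = "{0<..<T} \<times> \<Omega>" and ?e = "(1, 0) :: real \<times> 'a" and ?g = "\<lambda>(t, p). g t p"
  have S: "open ?S" using assms(1) by (intro open_Times) auto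
  have e: "?e \<in> Basis" by (simp add: Basis_prod_def)
  have sm: "smooth_bounded ?S (pdiff ?e ?g)" "smooth_bounded ?S (pdiff ?e (pdiff ?e ?g))"
    by (intro smooth_bounded_pdiff e g)+
  note d = smooth_bounded_differentiable[OF g] smooth_bounded_differentiable[OF sm(1)]
  obtain M where M: "\<And>x. x \<in> ?S \<Longrightarrow> \<bar>pdiff ?e (pdiff ?e ?g) x\<bar> \<le> M"
    using smooth_bounded_bounded[OF sm(2)] by auto
  have line: "((\<lambda>s. f (s, p)) has_real_derivative pdiff ?e f (t, p)) (at t)"
    if "f differentiable_on ?S" "0 < t" "t < T" "p \<in> \<Omega>" for f :: "real \<times> 'a \<Rightarrow> real" and t p
    using has_real_derivative_along_line[OF S that(1), of "(0, p)" t ?e] that by simp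
  have bound: "\<bar>(g (t + dt) p - g t p) / dt - deriv (\<lambda>\<tau>. g \<tau> p) t\<bar> \<le> \<bar>M\<bar> * dt"
    if t: "0 < t" "0 < dt" "t + dt < T" and p: "p \<in> \<Omega>" for t dt p
  proof -
    have D1: "((\<lambda>s. g s p) has_real_derivative pdiff ?e ?g (s, p)) (at s)" if "0 < s" "s < T" for s
      using line[OF d(1) that p] by simp
    obtain z where z: "t < z" "z < t + dt" and 1: "g (t + dt) p - g t p = (t + dt - t) * pdiff ?e ?g (z, p)"
      using MVT2[of t "t + dt" "\<lambda>s. g s p" "\<lambda>s. pdiff ?e ?g (s, p)"] D1 t by auto
    obtain z' where z': "t < z'" "z' < z" and
      2: "pdiff ?e ?g (z, p) - pdiff ?e ?g (t, p) = (z - t) * pdiff ?e (pdiff ?e ?g) (z', p)"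
      using MVT2[of t z "\<lambda>s. pdiff ?e ?g (s, p)" "\<lambda>s. pdiff ?e (pdiff ?e ?g) (s, p)"]
        line[OF d(2) _ _ p] t z by auto
    have "(g (t + dt) p - g t p) / dt - deriv (\<lambda>\<tau>. g \<tau> p) t
        = pdiff ?e ?g (z, p) - pdiff ?e ?g (t, p)"
      using 1 t DERIV_imp_deriv[OF D1[of t]] by simp
    also have "\<bar>\<dots>\<bar> = (z - t) * \<bar>pdiff ?e (pdiff ?e ?g) (z', p)\<bar>"
      using 2 z by (simp add: abs_mult)
    also have "\<dots> \<le> dt * \<bar>M\<bar>"
      using M[of "(z', p)"] z z' t p by (intro mult_mono) auto
    finally show ?thesis by (simp add: mult.commute)
  qed
  then show ?thesis by (intro exI[of _ "\<bar>M\<bar>"]) auto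
qed

text \<open>On an exact solution the diagnostic components vanish identically and the advection and Jacobian terms
cancel against the equations at time \<open>t\<close>, so only the forward differences of \<open>\<theta>\<close> and \<open>q\<close> contribute.\<close>

lemma TQG_defect_consistent:
  assumes \<Omega>: "open \<Omega>" "bounded \<Omega>"
  shows "TQG_consistent \<Omega> \<nu> \<beta> (TQG_defect \<nu> \<beta>)"
  unfolding TQG_consistent_def
proof (intro allI impI)
  fix T :: real and Y and e :: real
  assume sol: "TQG_solution \<Omega> \<nu> \<beta> T Y" and "e > 0"
  let ?S = "{0<..<T} \<times> \<Omega>"
  have S: "open ?S" "bounded ?S" using \<Omega> by (auto intro: open_Times bounded_Times)
  have sm: "smooth_bounded ?S (\<lambda>(t, p). vort0 (Y t) p)" "smooth_bounded ?S (\<lambda>(t, p). psi0 (Y t) p)"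
    "smooth_bounded ?S (\<lambda>(t, p). theta0 (Y t) p)"
    using sol unfolding TQG_solution_def by auto
  have "smooth_bounded ?S (\<lambda>x. (\<lambda>(t, p). vort0 (Y t) p) x + \<beta> * snd (snd x)
      - 1 / \<nu> * ((\<lambda>(t, p). psi0 (Y t) p) x - (\<lambda>(t, p). theta0 (Y t) p) x))"
    by (intro smooth_bounded_diff[OF S(1)] smooth_bounded_add[OF S(1)] sm
        smooth_bounded_bounded_linear[OF S(1) bounded_linear_mult_right]
        smooth_bounded_linear_map[OF S] bounded_linear_snd_comp bounded_linear_snd)
  then have q: "smooth_bounded ?S (\<lambda>(t, p). q0 \<nu> \<beta> (Y t) p)"
    by (simp add: q0_def phi0_def case_prod_unfold)
  obtain M1 where M1: "M1 \<ge> 0" "\<And>t dt p. 0 < t \<Longrightarrow> 0 < dt \<Longrightarrow> t + dt < T \<Longrightarrow> p \<in> \<Omega> \<Longrightarrow>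
      \<bar>(theta0 (Y (t + dt)) p - theta0 (Y t) p) / dt - deriv (\<lambda>\<tau>. theta0 (Y \<tau>) p) t\<bar> \<le> M1 * dt"
    using forward_difference_consistent[OF \<Omega>(1) sm(3)] by auto
  obtain M2 where M2: "M2 \<ge> 0" "\<And>t dt p. 0 < t \<Longrightarrow> 0 < dt \<Longrightarrow> t + dt < T \<Longrightarrow> p \<in> \<Omega> \<Longrightarrow>
      \<bar>(q0 \<nu> \<beta> (Y (t + dt)) p - q0 \<nu> \<beta> (Y t) p) / dt - deriv (\<lambda>\<tau>. q0 \<nu> \<beta> (Y \<tau>) p) t\<bar> \<le> M2 * dt"
    using forward_difference_consistent[OF \<Omega>(1) q] by auto
  have "norm (TQG_defect \<nu> \<beta> dt (Y t) (Y (t + dt)) p) \<le> (M1 + M2) * dt"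
    if t: "0 < t" "0 < dt" "t + dt < T" and p: "p \<in> \<Omega>" for t dt p
  proof -
    have "t \<in> {0<..<T}" "t + dt \<in> {0<..<T}" using t by auto
    then have eqs: "vel0 (Y (t + dt)) p = grad_perp (psi0 (Y (t + dt))) p"
      "laplacian (psi0 (Y (t + dt))) p = vort0 (Y (t + dt)) p"
      "deriv (\<lambda>\<tau>. theta0 (Y \<tau>) p) t + advect (vel0 (Y t)) (theta0 (Y t)) p = 0"
      "deriv (\<lambda>\<tau>. q0 \<nu> \<beta> (Y \<tau>) p) t + advect (vel0 (Y t)) (q0 \<nu> \<beta> (Y t)) p
         = 1 / \<nu> * jacobian (psi0 (Y t)) (theta0 (Y t)) p"
      using sol p unfolding TQG_solution_def geostrophic_def by blast+
    let ?x = "(theta0 (Y (t + dt)) p - theta0 (Y t) p) / dt - deriv (\<lambda>\<tau>. theta0 (Y \<tau>) p) t"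
    let ?z = "(q0 \<nu> \<beta> (Y (t + dt)) p - q0 \<nu> \<beta> (Y t) p) / dt - deriv (\<lambda>\<tau>. q0 \<nu> \<beta> (Y \<tau>) p) t"
    have "TQG_defect \<nu> \<beta> dt (Y t) (Y (t + dt)) p = (0, 0, ?x, ?z)"
      unfolding TQG_defect_def using eqs by (simp add: algebra_simps)
    then have "norm (TQG_defect \<nu> \<beta> dt (Y t) (Y (t + dt)) p) \<le> \<bar>?x\<bar> + \<bar>?z\<bar>"
      using norm_Pair_le[of ?x ?z] by (simp add: norm_Pair)
    also have "\<dots> \<le> M1 * dt + M2 * dt" by (intro add_mono M1(2) M2(2) t p)
    finally show ?thesis by (simp add: distrib_right)
  qed
  note bound = this
  have "\<forall>\<^sub>F dt in at_right 0. 0 < dt \<and> dt < e / (M1 + M2 + 1)"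
    using eventually_at_right_real[of 0 "e / (M1 + M2 + 1)"] \<open>e > 0\<close> M1(1) M2(1) by simp
  then show "\<forall>\<^sub>F dt in at_right 0. \<forall>t. 0 < t \<and> t + dt < T \<longrightarrow>
      (\<forall>p\<in>\<Omega>. norm (TQG_defect \<nu> \<beta> dt (Y t) (Y (t + dt)) p) < e)"
  proof eventually_elim
    case (elim dt)
    have "(M1 + M2) * dt \<le> (M1 + M2 + 1) * dt" using elim by simp
    also have "\<dots> < e" using elim M1(1) M2(1) by (simp add: field_simps)
    finally have "(M1 + M2) * dt < e" .
    with bound elim show ?case by (meson le_less_trans)
  qed
qed

theorem theorem3p1:
  fixes \<Omega> :: "(real \<times> real) set"
    and \<nu> \<beta> dt :: real
    and bc :: "nat \<Rightarrow> field set"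
    and Z :: "real \<Rightarrow> nat \<Rightarrow> trsw"
    and y0 :: tqg
  assumes domain: "open \<Omega>" "connected \<Omega>" "\<Omega> \<noteq> {}" "bounded \<Omega>"
    and params: "\<nu> > 0" "\<beta> \<ge> 0" "dt > 0"
    and bc: "\<And>n. elliptic_stable \<Omega> \<nu> (bc (Suc n))"
    and scheme: "\<And>n. \<forall>\<^sub>F \<epsilon> in at_right 0.
                   SI_step \<Omega> (bc (Suc n)) \<epsilon> \<nu> \<beta> dt (Z \<epsilon> n) (Z \<epsilon> (Suc n))"
    and initial: "expands_state \<Omega> \<nu> \<beta> (\<lambda>\<epsilon>. Z \<epsilon> 0) y0"
    and balanced: "geostrophic \<Omega> y0"
  shows "(\<exists>Y :: nat \<Rightarrow> tqg. Y 0 = y0 \<and>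
           (\<forall>n. expands_state \<Omega> \<nu> \<beta> (\<lambda>\<epsilon>. Z \<epsilon> n) (Y n) \<and>
                geostrophic \<Omega> (Y n) \<and>
                (\<forall>p\<in>\<Omega>. TQG_defect \<nu> \<beta> dt (Y n) (Y (Suc n)) p = 0)))
         \<and> TQG_consistent \<Omega> \<nu> \<beta> (TQG_defect \<nu> \<beta>)"
proof
  \<comment> \<open>The last conjunct pins the first term of the chosen sequence to the given \<open>y0\<close>.\<close>
  let ?P = "\<lambda>n y. expands_state \<Omega> \<nu> \<beta> (\<lambda>\<epsilon>. Z \<epsilon> n) y \<and> geostrophic \<Omega> y \<and> (n = 0 \<longrightarrow> y = y0)"
  have "\<exists>Y. \<forall>n. ?P n (Y n) \<and> (\<forall>p\<in>\<Omega>. TQG_defect \<nu> \<beta> dt (Y n) (Y (Suc n)) p = 0)"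
  proof (rule dependent_nat_choice)
    show "\<exists>y. ?P 0 y" using initial balanced by blast
    show "\<exists>y'. ?P (Suc n) y' \<and> (\<forall>p\<in>\<Omega>. TQG_defect \<nu> \<beta> dt y y' p = 0)" if "?P n y" for y n
      using SI_step_preserves_expansion[OF domain(1,3,4) params(1,3) bc scheme, of n y] that by auto
  qed
  then obtain Y where "\<And>n. ?P n (Y n) \<and> (\<forall>p\<in>\<Omega>. TQG_defect \<nu> \<beta> dt (Y n) (Y (Suc n)) p = 0)" by blast
  then show "\<exists>Y :: nat \<Rightarrow> tqg. Y 0 = y0 \<and>
      (\<forall>n. expands_state \<Omega> \<nu> \<beta> (\<lambda>\<epsilon>. Z \<epsilon> n) (Y n) \<and> geostrophic \<Omega> (Y n) \<and>
           (\<forall>p\<in>\<Omega>. TQG_defect \<nu> \<beta> dt (Y n) (Y (Suc n)) p = 0))"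
    by (intro exI[of _ Y]) blast
  show "TQG_consistent \<Omega> \<nu> \<beta> (TQG_defect \<nu> \<beta>)"
    by (rule TQG_defect_consistent[OF domain(1,4)])
qed

end
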